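(* Let $n$ and $s$ be integers with $s\ge 3$ and $n\ge 3s+1+\binom{2s+1}{s}\frac{s+1}{2}$. Then the maximum number of copies of $K_{s,s}$ in an $n$-vertex graph containing no copy of $C_{2s+2}$ is \[ \mathrm{ex}(n,K_{s,s},C_{2s+2})=\binom{n-s}{s}. \] Moreover, an $n$-vertex $C_{2s+2}$-free graph $G$ attains this value only if $G$ contains a copy of $K_{s,n-s}$ and $G$ is a subgraph of $K_s+H$, where $H$ is an $(n-s)$-vertex graph with exactly one edge.
   Context: $C_k$ denotes the cycle on $k$ vertices, $K_s$ the complete graph on $s$ vertices, and $K_{a,b}$ the complete bipartite graph with parts of sizes $a$ and $b$. For graphs $G$ and $H$, $G+H$ denotes their join: vertex-disjoint copies of $G$ and $H$ together with all edges between them. A copy of $H$ in $G$ is a (not necessarily induced) subgraph of $G$ isomorphic to $H$; $G$ is $F$-free if it contains no copy of $F$. $\mathrm{ex}(n,H,F)$ denotes the maximum number of copies of $H$ over all $n$-vertex $F$-free graphs. *)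

theory Defs
  imports Complex_Main
begin

text \<open>A graph is a pair of a vertex set and a set of two-element subsets of it.\<close>

type_synonym 'a graph = "'a set \<times> 'a set set"

abbreviation verts :: "'a graph \<Rightarrow> 'a set" where "verts \<equiv> fst"
abbreviation edges :: "'a graph \<Rightarrow> 'a set set" where "edges \<equiv> snd"

definition simple_graph :: "'a graph \<Rightarrow> bool" where
  "simple_graph G \<longleftrightarrow> finite (verts G) \<and> (\<forall>e\<in>edges G. e \<subseteq> verts G \<and> card e = 2)"

definition subgraph :: "'a graph \<Rightarrow> 'a graph \<Rightarrow> bool" where
  "subgraph H G \<longleftrightarrow> simple_graph H \<and> verts H \<subseteq> verts G \<and> edges H \<subseteq> edges G"

definition graph_iso :: "'a graph \<Rightarrow> 'b graph \<Rightarrow> bool" where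
  "graph_iso G H \<longleftrightarrow>
     (\<exists>f. bij_betw f (verts G) (verts H) \<and> edges H = (\<lambda>e. f ` e) ` edges G)"

definition copies :: "'b graph \<Rightarrow> 'a graph \<Rightarrow> 'a graph set" where
  "copies H G = {H'. subgraph H' G \<and> graph_iso H H'}"

definition contains_copy :: "'a graph \<Rightarrow> 'b graph \<Rightarrow> bool" where
  "contains_copy G H \<longleftrightarrow> copies H G \<noteq> {}"

text \<open>Meaningful as a cycle for \<open>k \<ge> 3\<close> only.\<close>

definition cycle_graph :: "nat \<Rightarrow> nat graph" where
  "cycle_graph k = ({..<k}, {{i, (i + 1) mod k} |i. i < k})"

definition complete_graph :: "nat \<Rightarrow> nat graph" where
  "complete_graph s = ({..<s}, {{i, j} |i j. i < s \<and> j < s \<and> i \<noteq> j})"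

definition complete_bipartite :: "nat \<Rightarrow> nat \<Rightarrow> (nat + nat) graph" where
  "complete_bipartite a b =
     (Inl ` {..<a} \<union> Inr ` {..<b}, {{Inl i, Inr j} |i j. i < a \<and> j < b})"

definition join :: "'a graph \<Rightarrow> 'b graph \<Rightarrow> ('a + 'b) graph" where
  "join G H =
     (Inl ` verts G \<union> Inr ` verts H,
      (\<lambda>e. Inl ` e) ` edges G \<union> (\<lambda>e. Inr ` e) ` edges H \<union>
      {{Inl u, Inr v} |u v. u \<in> verts G \<and> v \<in> verts H})"

definition free_graph :: "nat \<Rightarrow> 'b graph \<Rightarrow> 'a graph \<Rightarrow> bool" where
  "free_graph n F G \<longleftrightarrow> simple_graph G \<and> card (verts G) = n \<and> \<not> contains_copy G F"

text \<open>Since every finite graph is isomorphic to one on natural numbers, it suffices to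
  maximise over graphs with vertices in \<^typ>\<open>nat\<close>.\<close>

definition gen_turan :: "nat \<Rightarrow> 'b graph \<Rightarrow> 'c graph \<Rightarrow> nat" where
  "gen_turan n H F = Max {card (copies H G) |G :: nat graph. free_graph n F G}"

text \<open>The maximum is taken over a finite set, so it is a genuine one as soon as some
  \<open>n\<close>-vertex graph avoids \<open>F\<close>.\<close>

lemma copies_subset:
  assumes "simple_graph G"
  shows "copies H G \<subseteq> Pow (verts G) \<times> Pow (Pow (verts G))"
  using assms by (fastforce simp: copies_def subgraph_def simple_graph_def)

lemma finite_copies: "simple_graph G \<Longrightarrow> finite (copies H G)"
  by (rule finite_subset[OF copies_subset]) (auto simp: simple_graph_def)

lemma finite_gen_turan_values:
  "finite {card (copies H G) |G :: nat graph. free_graph n F G}"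
proof (rule finite_subset)
  show "{card (copies H G) |G :: nat graph. free_graph n F G} \<subseteq> {..2 ^ n * 2 ^ 2 ^ n}"
  proof
    fix c
    assume "c \<in> {card (copies H G) |G :: nat graph. free_graph n F G}"
    then obtain G :: "nat graph" where c: "c = card (copies H G)" and "free_graph n F G"
      by blast
    then have fin: "finite (verts G)" and n: "card (verts G) = n" and s: "simple_graph G"
      by (auto simp: free_graph_def simple_graph_def)
    have "c \<le> card (Pow (verts G) \<times> Pow (Pow (verts G)))"
      unfolding c using fin by (intro card_mono copies_subset[OF s]) simp
    then show "c \<in> {..2 ^ n * 2 ^ 2 ^ n}"
      using fin n by (simp add: card_cartesian_product card_Pow)
  qed
qed simp

end

theory Submission
  imports Defs
begin

text \<open>
  Call an \<open>s\<close>-set \<open>S\<close> rich if it has at least \<open>s + 2\<close> common neighbours. In a \<open>C\<^bsub>2s+2\<^esub>\<close>-free graph,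
  a vertex outside a rich \<open>S\<close> sees at most one common neighbour of \<open>S\<close>, so two rich sets have at most
  one common neighbour, and the copies of \<open>K\<^bsub>s,s\<^esub>\<close> with a rich side are controlled by counting pairs.
  Two copies without a rich side that share an edge have at most \<open>2s + 1\<close> vertices in total;
  hence an edge lies in at most as many of them as in \<open>K\<^bsub>2s+1\<^esub>\<close>, and there are only
  quadratically many. If no rich set has more than \<open>(n - s) / 2\<close> common neighbours, these
  two estimates already keep the count strictly below \<open>binom(n - s, s)\<close>. Otherwise fix a rich \<open>S\<close> with
  \<open>m > (n - s) / 2\<close> common neighbours: all copies without \<open>S\<close> as a side have at most one vertex per
  side in the common neighbourhood of \<open>S\<close>, so they essentially live on the other \<open>n - m\<close> vertices, and the count is
  strictly below \<open>binom(n - s, s)\<close> unless \<open>m = n - s\<close>. In that case the absence of \<open>C\<^bsub>2s+2\<^esub>\<close>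
  leaves room for at most one edge outside \<open>S\<close>.
\<close>

subsection \<open>Binomial estimates\<close>

lemma self_le_choose:
  fixes k n :: nat
  assumes "1 \<le> k" "k < n"
  shows "n \<le> n choose k"
  using assms
proof (induction n arbitrary: k)
  case 0
  then show ?case by simp
next
  case (Suc n)
  obtain j where j: "k = Suc j"
    using Suc.prems by (cases k) auto
  show ?case
  proof (cases "k < n")
    case True
    then have "n \<le> n choose k" "0 < n choose j"
      using Suc j by (auto simp: zero_less_binomial)
    then have "Suc n \<le> (n choose j) + (n choose k)"
      by linarith
    then show ?thesis
      using j by simp
  next
    case False
    then have "k = n"
      using Suc.prems by simp
    then show ?thesis
      using binomial_symmetric[of 1 "Suc n"] by simp
  qed
qed

text \<open>By absorption \<open>j * (a choose j) = a * ((a - 1) choose (j - 1))\<close>, so the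
  factor 2 only has to be carried by the leading \<open>a\<close>.\<close>

lemma double_choose_le:
  fixes a b j :: nat
  assumes "2 * a \<le> b" "1 \<le> j"
  shows "2 * (a choose j) \<le> b choose j"
proof -
  have "j * (2 * (a choose j)) = 2 * a * ((a - 1) choose (j - 1))"
    using times_binomial_minus1_eq[of j a] assms(2) by simp
  also have "\<dots> \<le> b * ((b - 1) choose (j - 1))"
    using assms(1) by (intro mult_le_mono binomial_right_mono) auto
  also have "\<dots> = j * (b choose j)"
    using times_binomial_minus1_eq[of j b] assms(2) by simp
  finally show ?thesis
    using assms(2) by simp
qed

lemma two_choose_two: "2 * (n choose 2) = n * (n - 1)" for n :: nat
  using times_binomial_minus1_eq[of 2 n] by simp

text \<open>This is the increment in the induction on \<open>M\<close> of
  \<open>choose_superadditive\<close>. Passing from \<open>r\<close> to \<open>Suc r\<close> raises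
  the left side by \<open>2 * (t + r) + 1\<close> and the right side by
  \<open>2 * ((t + r) choose (s - 2)) + 1\<close>; since \<open>s - 2\<close> is positive and below
  \<open>t + r\<close>, \<open>self_le_choose\<close> compares them.\<close>

lemma choose_add_ge:
  fixes s t r :: nat
  assumes "3 \<le> s" "s < t"
  shows "2 * (t choose (s - 1)) + r * (2 * t + r) \<le> 2 * ((t + r) choose (s - 1)) + r"
proof (induction r)
  case 0
  then show ?case by simp
next
  case (Suc r)
  obtain u where u: "s = u + 2"
    using assms(1) le_Suc_ex[of 2 s] by auto
  have "t + r \<le> (t + r) choose u"
    using u assms by (intro self_le_choose) auto
  moreover have "(t + Suc r) choose (s - 1) = ((t + r) choose u) + ((t + r) choose (s - 1))"
    using u by simp
  ultimately show ?case
    using Suc by (simp add: algebra_simps)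
qed

text \<open>Replacing ground sets of sizes \<open>s + 1 + M\<close> and \<open>s + 1 + r\<close> by
  a single one of size \<open>s + 1 + M + r\<close> gains a cubic number of
  \<open>s\<close>-subsets; this surplus later pays for the copies without a rich side. Pascal's
  rule turns each step in \<open>M\<close> into \<open>choose_add_ge\<close>.\<close>

lemma choose_superadditive:
  fixes s M r :: nat
  assumes "3 \<le> s"
  shows "2 * ((s + 1 + M) choose s) + 2 * ((s + 1 + r) choose s) + r * M * (2 * s + M + r)
    \<le> 2 * ((s + 1 + M + r) choose s) + 2 * (s + 1)"
proof (induction M)
  case 0
  have "(s + 1) choose s = s + 1"
    using binomial_symmetric[of 1 "s + 1"] by simp
  then show ?case by simp
next
  case (Suc M)
  obtain u where u: "s = Suc u"
    using assms by (cases s) auto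
  have "(s + 1 + Suc M) choose s = ((s + 1 + M) choose (s - 1)) + ((s + 1 + M) choose s)"
    "(s + 1 + Suc M + r) choose s = ((s + 1 + M + r) choose (s - 1)) + ((s + 1 + M + r) choose s)"
    using u by simp_all
  then show ?case
    using Suc choose_add_ge[of s "s + 1 + M" r] assms by (simp add: algebra_simps)
qed

text \<open>The hypotheses on \<open>m\<close>, \<open>r\<close>, \<open>n\<close> say that \<open>m\<close> of the \<open>n - s\<close> vertices outside a
  rich set are common neighbours of it and \<open>r\<close> are not.\<close>

lemma near_extremal_bound:
  fixes s n m r P p :: nat
  assumes s: "3 \<le> s" and n: "n = m + r + s" and r: "1 \<le> r" "r < m"
    and P: "2 * s - 1 \<le> P" "3 * s + 1 + (2 * s + 1) * P \<le> n"
    and p: "(s - 1)\<^sup>2 * p \<le> s * P * ((r + s) choose 2)"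
  shows "(m choose s) + ((r + s + 1) choose s) + p < (n - s) choose s"
proof -
  have "5 \<le> P" using P s by linarith
  have "(2 * s + 1) * P \<ge> 7 * P"
    using s by (intro mult_le_mono) auto
  then have big: "3 * s + 1 + 7 * P \<le> m + r + s"
    using P n by linarith
  then have "s + 1 \<le> m"
    using r by linarith
  then obtain M where M: "m = s + 1 + M"
    using le_Suc_ex by blast
  have rM: "r \<le> M + s"
    using r M by simp
  \<comment> \<open>The \<open>3 * s + 1\<close> in the bound on \<open>n\<close> cancels exactly:
    \<open>r \<le> M + s\<close> gives \<open>m + r + s \<le> 3 * s + 1 + 2 * M\<close>.\<close>
  have P7: "7 * P \<le> 2 * M"
    using big M rM by linarith
  have MsP: "(2 * s + 1) * P \<le> 2 * M"
    using P(2) n M rM by linarith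
  have "(2 * s + 1) * (2 * s - 1) \<le> (2 * s + 1) * P"
    using P(1) by (intro mult_left_mono) auto
  then have "(2 * s + 1) * (2 * s - 1) \<le> 2 * M"
    using MsP by linarith
  \<comment> \<open>Parity gains one: \<open>4 * s * s - 1 \<le> 2 * M\<close> already forces
    \<open>4 * s * s \<le> 2 * M\<close>.\<close>
  moreover have "(2 * s + 1) * (2 * s - 1) + 1 = 4 * s * s"
    using s by (cases s) (auto simp: algebra_simps)
  ultimately have Ms: "2 * s * s \<le> M"
    by linarith
  have p': "8 * p \<le> 3 * P * ((r + s) * (r + s - 1))"
  proof -
    \<comment> \<open>Tight at \<open>s = 3\<close>. It replaces the square by a multiple of
      \<open>s\<close>, which then cancels; the 8 in front of \<open>p\<close> is this 4 times the 2
      that clears the binomial.\<close>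
    have "4 * s \<le> 3 * (s - 1)\<^sup>2"
    proof -
      obtain t where "s = t + 3" using s le_Suc_ex[of 3 s] by auto
      then show ?thesis by (simp add: power2_eq_square algebra_simps)
    qed
    then have "4 * s * p \<le> 3 * (s - 1)\<^sup>2 * p"
      by (intro mult_right_mono) auto
    also have "\<dots> \<le> 3 * (s * P * ((r + s) choose 2))"
      using p by simp
    finally have "s * (8 * p) \<le> s * (3 * P * (2 * ((r + s) choose 2)))"
      by (simp add: algebra_simps)
    then show ?thesis
      using s unfolding two_choose_two by simp
  qed
  have "(r + s) * (r + s - 1) \<le> r * (r + M)"
  proof -
    obtain u where u: "s = Suc u" using s by (cases s) auto
    have "(r + s) * (r + s - 1) = r * (r + 2 * u + 1) + s * u"
      using u by (simp add: algebra_simps)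
    also have "s * u \<le> r * (s * u)"
      using r by simp
    also have "r * (r + 2 * u + 1) + r * (s * u) = r * (r + 2 * u + 1 + s * u)"
      by (simp add: algebra_simps)
    also have "2 * u + 1 + s * u \<le> M"
    proof -
      have "2 * s \<le> s * s" using s by simp
      then have "2 * u + 1 + s * u \<le> 2 * s * s"
        using u by (simp add: algebra_simps)
      then show ?thesis using Ms by linarith
    qed
    then have "r * (r + 2 * u + 1 + s * u) \<le> r * (r + M)"
      by (intro mult_left_mono) auto
    finally show ?thesis by simp
  qed
  then have "3 * P * ((r + s) * (r + s - 1)) \<le> 3 * P * (r * (r + M))"
    by (intro mult_left_mono) auto
  \<comment> \<open>56 is 8 times 7, with the 7 placed next to \<open>P\<close> so that
    \<open>P7\<close> can replace \<open>P\<close> by a multiple of \<open>M\<close>.\<close>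
  with p' have "56 * p \<le> 3 * (7 * P) * (r * (r + M))"
    by linarith
  also have "\<dots> \<le> 3 * (2 * M) * (r * (r + M))"
    using P7 by (intro mult_le_mono1 mult_le_mono2)
  finally have p'': "56 * p \<le> 6 * (r * M * (r + M))"
    by (simp add: algebra_simps)
  have "2 * (s + 1) < r * M * (2 * s)"
  proof -
    have "s + 1 < M"
    proof -
      have "3 * s \<le> s * s" using s by simp
      then show ?thesis using Ms s by linarith
    qed
    also have "M \<le> r * M" using r by simp
    finally have "s + 1 < r * M" .
    then have "2 * (s + 1) < 2 * (r * M)" by simp
    also have "\<dots> \<le> r * M * (2 * s)" using s by simp
    finally show ?thesis .
  qed
  moreover have "2 * p \<le> r * M * (r + M)"
    using p'' by linarith
  ultimately have "2 * p + 2 * (s + 1) < r * M * (2 * s + M + r)"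
    by (simp add: algebra_simps)
  then have "(s + 1 + M choose s) + (s + 1 + r choose s) + p < (s + 1 + M + r) choose s"
    using choose_superadditive[OF s, of M r] by linarith
  moreover have "n - s = s + 1 + M + r" "r + s + 1 = s + 1 + r"
    using n M by simp_all
  ultimately show ?thesis
    by (simp only: M)
qed

text \<open>After scaling by \<open>s choose 2\<close>, everything is measured against
  \<open>(n choose 2) * X\<close>: \<open>R\<close> takes at most one half and \<open>p\<close> at
  most one quarter of it. The target becomes \<open>((n - s) choose 2) * X\<close>, which exceeds
  three quarters because \<open>n\<close> is large compared with \<open>s\<close>.\<close>

lemma far_from_extremal_bound:
  fixes s n P p R :: nat
  assumes s: "3 \<le> s"
    and P: "2 * s - 1 \<le> P" "3 * s + 1 + (2 * s + 1) * P \<le> n"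
    and p: "s\<^sup>2 * p \<le> s * P * (n choose 2)"
    and R: "2 * ((s choose 2) * R) \<le> (n choose 2) * ((n - s - 2) choose (s - 2))"
  shows "R + p < (n - s) choose s"
proof -
  define X where "X = (n - s - 2) choose (s - 2)"
  \<comment> \<open>The lower bound on \<open>n\<close> makes \<open>n - s - 2\<close> at least
    \<open>(2 * s + 1) * P\<close>; \<open>s \<ge> 3\<close> keeps the lower index
    \<open>s - 2\<close> of \<open>X\<close> positive, so \<open>X\<close> is at least
    \<open>n - s - 2\<close>.\<close>
  have PX: "2 * (s - 1) * P \<le> X"
  proof -
    have "2 * (s - 1) * P \<le> (2 * s + 1) * P"
      by (intro mult_right_mono) auto
    then have "2 * (s - 1) * P \<le> n - s - 2"
      using P(2) s by linarith
    also have "\<dots> \<le> X"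
      unfolding X_def using s P(2) by (intro self_le_choose) auto
    finally show ?thesis .
  qed
  have sp: "s * p \<le> P * (n choose 2)"
    using p s by (simp add: power2_eq_square mult.assoc)
  have "4 * ((s choose 2) * p) = 2 * (s - 1) * (s * p)"
    using two_choose_two[of s] by (metis (no_types, lifting) mult.assoc mult.commute mult_2 numeral_Bit0 distrib_right)
  also have "\<dots> \<le> 2 * (s - 1) * (P * (n choose 2))"
    using sp by (intro mult_left_mono) auto
  also have "\<dots> \<le> X * (n choose 2)"
    using mult_right_mono[OF PX, of "n choose 2"] by (simp add: mult.assoc)
  finally have p': "4 * ((s choose 2) * p) \<le> X * (n choose 2)" .
  have n8: "8 * (s + 1) \<le> n"
  proof -
    have "3 * s + 1 + (2 * s + 1) * 5 \<le> 3 * s + 1 + (2 * s + 1) * P"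
      using P(1) s by (intro add_left_mono mult_left_mono) auto
    also note P(2)
    finally show ?thesis using s by simp
  qed
  have quad: "3 * (n choose 2) < 4 * ((n - s) choose 2)"
  proof -
    obtain k where k: "n = 8 * (s + 1) + k"
      using n8 le_Suc_ex by blast
    have "n - s = 7 * s + 8 + k" "n - s - 1 = 7 * s + 7 + k" "n - 1 = 8 * s + 7 + k"
      using k by simp_all
    then have "3 * (n * (n - 1)) < 4 * ((n - s) * (n - s - 1))"
      using k by (simp add: algebra_simps)
    then have "3 * (2 * (n choose 2)) < 4 * (2 * ((n - s) choose 2))"
      unfolding two_choose_two .
    then show ?thesis by simp
  qed
  have X0: "0 < X"
    unfolding X_def using s P(2) by (simp add: zero_less_binomial)
  have "4 * ((s choose 2) * (R + p)) \<le> 3 * (n choose 2) * X"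
    using p' R unfolding X_def by (simp add: algebra_simps)
  also have "\<dots> < 4 * ((n - s) choose 2) * X"
    using quad X0 by simp
  also have "\<dots> = 4 * ((s choose 2) * ((n - s) choose s))"
    using choose_mult[of 2 s "n - s"] s P(2) unfolding X_def by (simp add: mult.commute)
  finally show ?thesis by simp
qed

subsection \<open>Bicliques and their copies\<close>

definition biclique :: "'a set \<Rightarrow> 'a set \<Rightarrow> 'a graph" where
  "biclique A B = (A \<union> B, {{a, b} |a b. a \<in> A \<and> b \<in> B})"

definition common_nbrs :: "'a graph \<Rightarrow> 'a set \<Rightarrow> 'a set" where
  "common_nbrs G A = {v \<in> verts G. \<forall>a\<in>A. {a, v} \<in> edges G}"

lemma biclique_commute: "biclique A B = biclique B A"
  unfolding biclique_def by (auto simp: insert_commute)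

text \<open>Copies need not be induced, so an injective map preserving edges suffices: its image is
  the copy.\<close>

lemma contains_copyI:
  assumes "simple_graph G" "simple_graph H" "inj_on f (verts H)" "f ` verts H \<subseteq> verts G"
    and "\<And>e. e \<in> edges H \<Longrightarrow> f ` e \<in> edges G"
  shows "contains_copy G H"
proof -
  let ?H = "(f ` verts H, (`) f ` edges H)"
  have "card (f ` e) = 2" if "e \<in> edges H" for e
    using that assms(2,3) by (metis card_image inj_on_subset simple_graph_def)
  moreover have "f ` e \<subseteq> f ` verts H" if "e \<in> edges H" for e
    using that assms(2) by (auto simp: simple_graph_def)
  ultimately have "subgraph ?H G"
    using assms by (auto simp: subgraph_def simple_graph_def)
  moreover have "graph_iso H ?H"
    unfolding graph_iso_def using assms(3) by (auto simp: bij_betw_def intro!: exI[of _ f])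
  ultimately show ?thesis
    by (auto simp: contains_copy_def copies_def)
qed

lemma contains_copyE:
  assumes "contains_copy G H"
  obtains f where "inj_on f (verts H)" "f ` verts H \<subseteq> verts G"
    "\<And>e. e \<in> edges H \<Longrightarrow> f ` e \<in> edges G"
proof -
  obtain H' where "subgraph H' G" "graph_iso H H'"
    using assms by (auto simp: contains_copy_def copies_def)
  then obtain f where f: "bij_betw f (verts H) (verts H')" "edges H' = (`) f ` edges H"
    and "verts H' \<subseteq> verts G" "edges H' \<subseteq> edges G"
    by (auto simp: graph_iso_def subgraph_def)
  then show ?thesis
    by (intro that[of f]) (auto simp: bij_betw_def)
qed

text \<open>The two sides are the images of the two summands under an isomorphism. From here on
  copies are handled through concrete vertex sets; for \<open>a = b\<close> the pair of sides is
  determined only up to exchange.\<close>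

lemma copies_complete_bipartite:
  assumes G: "simple_graph G"
  shows "copies (complete_bipartite a b) G =
    {biclique A B |A B. A \<subseteq> verts G \<and> card A = a \<and> B \<subseteq> common_nbrs G A \<and> card B = b}"
    (is "?L = ?R")
proof
  let ?K = "complete_bipartite a b"
  have fin: "finite (verts G)"
    using G by (simp add: simple_graph_def)
  show "?L \<subseteq> ?R"
  proof
    fix H assume "H \<in> ?L"
    then obtain f where sub: "verts H \<subseteq> verts G" "edges H \<subseteq> edges G"
      and bij: "bij_betw f (verts ?K) (verts H)" and E: "edges H = (`) f ` edges ?K"
      by (auto simp: copies_def subgraph_def graph_iso_def)
    define A where "A = f ` Inl ` {..<a}"
    define B where "B = f ` Inr ` {..<b}"
    have V: "verts ?K = Inl ` {..<a} \<union> Inr ` {..<b}"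
      and EK: "edges ?K = {{Inl i, Inr j} |i j. i < a \<and> j < b}"
      by (simp_all add: complete_bipartite_def)
    have inj: "inj_on f (Inl ` {..<a} \<union> Inr ` {..<b})" and im: "verts H = A \<union> B"
      using bij unfolding bij_betw_def V A_def B_def by (simp_all add: image_Un)
    have "inj_on f (Inl ` {..<a})" "inj_on f (Inr ` {..<b})"
      using inj by (auto intro: inj_on_subset)
    then have "card A = a" "card B = b"
      unfolding A_def B_def by (simp_all add: card_image inj_on_def)
    moreover have EH: "edges H = {{x, y} |x y. x \<in> A \<and> y \<in> B}"
    proof (rule set_eqI)
      fix e
      have "e \<in> edges H \<longleftrightarrow> (\<exists>i j. i < a \<and> j < b \<and> e = {f (Inl i), f (Inr j)})"
        unfolding E EK by (auto simp: image_iff)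
      also have "\<dots> \<longleftrightarrow> e \<in> {{x, y} |x y. x \<in> A \<and> y \<in> B}"
        unfolding A_def B_def by blast
      finally show "e \<in> edges H \<longleftrightarrow> e \<in> {{x, y} |x y. x \<in> A \<and> y \<in> B}" .
    qed
    moreover have "A \<subseteq> verts G" "B \<subseteq> common_nbrs G A"
      using sub im EH unfolding common_nbrs_def by blast+
    moreover have "H = biclique A B"
      unfolding biclique_def using EH im by (simp add: prod_eq_iff)
    ultimately show "H \<in> ?R" by blast
  qed
  show "?R \<subseteq> ?L"
  proof
    fix H assume "H \<in> ?R"
    then obtain A B where H: "H = biclique A B" and A: "A \<subseteq> verts G" "card A = a"
      and B: "B \<subseteq> common_nbrs G A" "card B = b" by blast
    have sing: "{x} \<notin> edges G" for x
      using G by (auto simp: simple_graph_def)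
    have BV: "B \<subseteq> verts G"
      using B by (auto simp: common_nbrs_def)
    have dis: "A \<inter> B = {}"
      using B sing by (fastforce simp: common_nbrs_def)
    have "finite A" "finite B"
      using A BV fin by (auto intro: finite_subset)
    then obtain g h where g: "bij_betw g {..<a} A" and h: "bij_betw h {..<b} B"
      using A(2) B(2) ex_bij_betw_nat_finite by (metis atLeast0LessThan)
    define f where "f = case_sum g h"
    have gA: "g ` {..<a} = A" and hB: "h ` {..<b} = B"
      using g h by (auto simp: bij_betw_def)
    have "g i \<noteq> h j" if "i < a" "j < b" for i j
      using that dis gA hB by blast
    then have "inj_on f (verts ?K)"
      unfolding f_def complete_bipartite_def inj_on_def using g h
      by (force simp: bij_betw_def inj_on_def)
    moreover have "f ` verts ?K = A \<union> B"
      unfolding f_def complete_bipartite_def using gA hB by (simp add: image_Un image_image)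
    ultimately have bij: "bij_betw f (verts ?K) (verts H)"
      by (simp add: H biclique_def bij_betw_def)
    have "edges ?K = (\<lambda>(i, j). {Inl i, Inr j}) ` ({..<a} \<times> {..<b})"
      by (auto simp: complete_bipartite_def)
    then have "(`) f ` edges ?K = (\<lambda>(i, j). {g i, h j}) ` ({..<a} \<times> {..<b})"
      by (simp add: image_image f_def case_prod_beta)
    also have "\<dots> = edges H"
      unfolding H biclique_def gA[symmetric] hB[symmetric] by auto
    finally have "graph_iso ?K H"
      unfolding graph_iso_def using bij by blast
    moreover have "edges H \<subseteq> edges G"
      using B unfolding H biclique_def common_nbrs_def by auto
    moreover have "verts H \<subseteq> verts G"
      using A BV unfolding H biclique_def by auto
    moreover have "simple_graph H"
      using G \<open>finite A\<close> \<open>finite B\<close> calculation(2,3) unfolding simple_graph_def H biclique_def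
      by (auto dest!: subsetD)
    ultimately show "H \<in> ?L"
      by (auto simp: copies_def subgraph_def)
  qed
qed

lemma simple_biclique:
  assumes "finite A" "finite B" "A \<inter> B = {}"
  shows "simple_graph (biclique A B)"
  using assms by (auto simp: simple_graph_def biclique_def card_insert_if)

text \<open>Every second edge of the cycle has an end in \<open>A\<close>, and these edges are disjoint.\<close>

lemma biclique_no_long_cycle:
  assumes "finite A" "card A < k"
  shows "\<not> contains_copy (biclique A B) (cycle_graph (2 * k))"
proof
  assume "contains_copy (biclique A B) (cycle_graph (2 * k))"
  then obtain f where inj: "inj_on f {..<2 * k}"
    and E: "\<And>e. e \<in> edges (cycle_graph (2 * k)) \<Longrightarrow> f ` e \<in> edges (biclique A B)"
    by (auto elim!: contains_copyE simp: cycle_graph_def)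
  \<comment> \<open>The edge numbered \<open>j\<close> joins positions \<open>2 * j\<close> and
    \<open>2 * j + 1\<close>; \<open>i div 2 = j\<close> records the edge, so that different edges
    yield different vertices of \<open>A\<close>.\<close>
  have "\<exists>i. i < 2 * k \<and> i div 2 = j \<and> f i \<in> A" if "j < k" for j
  proof -
    have "{2 * j, 2 * j + 1} \<in> edges (cycle_graph (2 * k))"
      unfolding cycle_graph_def using that by (auto intro!: exI[of _ "2 * j"])
    then have "{f (2 * j), f (2 * j + 1)} \<in> edges (biclique A B)"
      using E[of "{2 * j, 2 * j + 1}"] by simp
    then have "f (2 * j) \<in> A \<or> f (2 * j + 1) \<in> A"
      by (auto simp: biclique_def doubleton_eq_iff)
    then show ?thesis
    proof
      assume "f (2 * j) \<in> A"
      then show ?thesis using that by (intro exI[of _ "2 * j"]) simp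
    next
      assume "f (2 * j + 1) \<in> A"
      then show ?thesis using that by (intro exI[of _ "2 * j + 1"]) simp
    qed
  qed
  then obtain c where c: "\<And>j. j < k \<Longrightarrow> c j < 2 * k \<and> c j div 2 = j \<and> f (c j) \<in> A"
    by metis
  have "inj_on (\<lambda>j. f (c j)) {..<k}"
  proof (rule inj_onI)
    fix i j assume ij: "i \<in> {..<k}" "j \<in> {..<k}" "f (c i) = f (c j)"
    then have "c i = c j"
      using inj_onD[OF inj ij(3)] c by simp
    moreover have "c i div 2 = i" "c j div 2 = j"
      using c ij by blast+
    ultimately show "i = j"
      by metis
  qed
  then have "card {..<k} \<le> card A"
    using c assms(1) by (intro card_inj_on_le) auto
  then show False
    using assms(2) by simp
qed

text \<open>Keep \<open>A\<close> as one side and let the other side range over the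
  \<open>b\<close>-subsets of \<open>B\<close>; such a subset is recovered from the copy by removing
  \<open>A\<close> from its vertices.\<close>

lemma card_copies_biclique_ge:
  assumes "finite A" "finite B" "A \<inter> B = {}" "card A = a"
  shows "card B choose b \<le> card (copies (complete_bipartite a b) (biclique A B))"
proof -
  let ?G = "biclique A B"
  have G: "simple_graph ?G"
    by (rule simple_biclique) fact+
  have "B \<subseteq> common_nbrs ?G A"
    by (auto simp: common_nbrs_def biclique_def)
  then have sub: "biclique A ` {T. T \<subseteq> B \<and> card T = b} \<subseteq> copies (complete_bipartite a b) ?G"
    unfolding copies_complete_bipartite[OF G] using assms(4) by (fastforce simp: biclique_def)
  have "inj_on (biclique A) {T. T \<subseteq> B \<and> card T = b}"
  proof (rule inj_onI)
    fix T T' assume T: "T \<in> {T. T \<subseteq> B \<and> card T = b}" "T' \<in> {T. T \<subseteq> B \<and> card T = b}"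
      and "biclique A T = biclique A T'"
    then have "A \<union> T = A \<union> T'" "T \<inter> A = {}" "T' \<inter> A = {}"
      using assms(3) by (auto simp: biclique_def)
    then show "T = T'" by blast
  qed
  then have "card (biclique A ` {T. T \<subseteq> B \<and> card T = b}) = card B choose b"
    using n_subsets[OF assms(2)] by (simp add: card_image)
  then show ?thesis
    using card_mono[OF finite_copies[OF G] sub] by simp
qed

section \<open>Joins, and spanning alternating paths\<close>

lemma simple_complete_graph: "simple_graph (complete_graph s)"
  by (auto simp: simple_graph_def complete_graph_def)

lemma simple_graph_join:
  assumes "simple_graph G" "simple_graph H"
  shows "simple_graph (join G H)"
proof -
  have "e \<subseteq> verts (join G H) \<and> card e = 2" if "e \<in> edges (join G H)" for e
  proof -
    consider e' where "e' \<in> edges G" "e = Inl ` e'" | e' where "e' \<in> edges H" "e = Inr ` e'"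
      | u v where "u \<in> verts G" "v \<in> verts H" "e = {Inl u, Inr v}"
      using \<open>e \<in> edges (join G H)\<close> unfolding join_def by auto
    then show ?thesis
    proof cases
      case 1
      then have "e' \<subseteq> verts G" "card e' = 2"
        using assms(1) by (auto simp: simple_graph_def)
      then show ?thesis
        using 1 by (auto simp: join_def card_image)
    next
      case 2
      then have "e' \<subseteq> verts H" "card e' = 2"
        using assms(2) by (auto simp: simple_graph_def)
      then show ?thesis
        using 2 by (auto simp: join_def card_image)
    qed (auto simp: join_def)
  qed
  then show ?thesis
    using assms by (simp add: simple_graph_def) (simp add: join_def)
qed

lemma card_pair_edges:
  assumes "finite A" "finite B" "A \<inter> B = {}"
  shows "card {{a, b} |a b. a \<in> A \<and> b \<in> B} = card A * card B"
proof -
  have "{{a, b} |a b. a \<in> A \<and> b \<in> B} = (\<lambda>(a, b). {a, b}) ` (A \<times> B)"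
    by auto
  moreover have "inj_on (\<lambda>(a, b). {a, b}) (A \<times> B)"
    using assms(3) by (auto simp: inj_on_def doubleton_eq_iff)
  ultimately show ?thesis
    by (simp add: card_image card_cartesian_product)
qed

text \<open>These paths are the building blocks of all forbidden cycles below. Induction peels off
  \<open>x\<close> and some \<open>y'\<close> other than the prescribed end \<open>y\<close>, and
  continues from any other vertex of \<open>X\<close>.\<close>

lemma path_in_biclique:
  assumes "finite X" "finite Y" "X \<inter> Y = {}" "card X = card Y" "x \<in> X" "y \<in> Y"
    and "\<And>a b. a \<in> X \<Longrightarrow> b \<in> Y \<Longrightarrow> R a b \<and> R b a"
  shows "\<exists>p. p \<noteq> [] \<and> hd p = x \<and> last p = y \<and> distinct p \<and> set p = X \<union> Y \<and> successively R p"
  using assms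
proof (induction "card X" arbitrary: X Y x)
  case 0
  then show ?case by simp
next
  case (Suc k)
  show ?case
  proof (cases "k = 0")
    case True
    then have "X = {x}" "Y = {y}"
      using Suc.hyps(2) Suc.prems(4,5,6) by (metis One_nat_def card_1_singletonE singletonD)+
    then show ?thesis
      using Suc.prems by (intro exI[of _ "[x, y]"]) auto
  next
    case False
    have "card (X - {x}) = k" "card (Y - {y}) = k"
      using Suc.hyps(2) Suc.prems by auto
    then obtain x' y' where x': "x' \<in> X - {x}" and y': "y' \<in> Y - {y}"
      using False by (metis all_not_in_conv card.empty)
    have "\<exists>p. p \<noteq> [] \<and> hd p = x' \<and> last p = y \<and> distinct p \<and>
        set p = (X - {x}) \<union> (Y - {y'}) \<and> successively R p"
      using Suc.hyps(2) Suc.prems x' y' by (intro Suc.hyps(1)) auto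
    then obtain p where p: "p \<noteq> []" "hd p = x'" "last p = y" "distinct p"
      "set p = (X - {x}) \<union> (Y - {y'})" "successively R p" by blast
    have "y' \<notin> X" "x \<notin> Y" "x \<noteq> y'"
      using Suc.prems x' y' by auto
    then show ?thesis
      using p Suc.prems x' y'
      by (intro exI[of _ "x # y' # p"]) (auto simp: successively_Cons)
  qed
qed

text \<open>When one side has one vertex more, both ends lie on it: start at \<open>y\<close> and
  continue with a balanced path avoiding \<open>y\<close>.\<close>

lemma path_in_biclique_same_side:
  assumes "finite X" "finite Y" "X \<inter> Y = {}" "card Y = Suc (card X)" "y \<in> Y" "y' \<in> Y" "y \<noteq> y'"
    and R: "\<And>a b. a \<in> X \<Longrightarrow> b \<in> Y \<Longrightarrow> R a b \<and> R b a"
  shows "\<exists>p. p \<noteq> [] \<and> hd p = y \<and> last p = y' \<and> distinct p \<and> set p = X \<union> Y \<and> successively R p"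
proof -
  have "card Y \<noteq> 1"
    using assms by (metis card_1_singletonE singletonD)
  then obtain x where x: "x \<in> X"
    using assms by (metis One_nat_def all_not_in_conv card.empty)
  have "\<exists>p. p \<noteq> [] \<and> hd p = x \<and> last p = y' \<and> distinct p \<and> set p = X \<union> (Y - {y}) \<and> successively R p"
    using assms x by (intro path_in_biclique) auto
  then obtain p where "p \<noteq> []" "hd p = x" "last p = y'" "distinct p"
      "set p = X \<union> (Y - {y})" "successively R p" by blast
  then show ?thesis
    using assms x by (intro exI[of _ "y # p"]) (auto simp: successively_Cons)
qed

subsection \<open>Rich sets\<close>

locale even_cycle_free =
  fixes G :: "'a graph" and s :: nat
  assumes simple: "simple_graph G"
    and s3: "3 \<le> s"
    and cycle_free: "\<not> contains_copy G (cycle_graph (2 * s + 2))"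
begin

abbreviation "V \<equiv> verts G"
abbreviation "N \<equiv> common_nbrs G"
abbreviation "adj x y \<equiv> {x, y} \<in> edges G"

text \<open>The threshold \<open>s + 2\<close> leaves \<open>s - 1\<close> common neighbours after
  three vertices are discarded and \<open>s - 2\<close> after four, which is what the two cycle
  constructions below consume.\<close>

definition rich :: "'a set \<Rightarrow> bool" where
  "rich S \<longleftrightarrow> S \<subseteq> V \<and> card S = s \<and> s + 2 \<le> card (N S)"

lemma finV: "finite V"
  using simple by (simp add: simple_graph_def)

lemma adj_commute: "adj x y \<longleftrightarrow> adj y x"
  by (simp add: insert_commute)

lemma not_adj_self: "\<not> adj x x"
  using simple by (auto simp: simple_graph_def)

lemma adj_verts: "adj x y \<Longrightarrow> x \<in> V \<and> y \<in> V"
  using simple by (auto simp: simple_graph_def)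

lemma N_subset: "N A \<subseteq> V"
  by (auto simp: common_nbrs_def)

lemma finN: "finite (N A)"
  using N_subset finV finite_subset by blast

lemma in_N_adj: "v \<in> N A \<Longrightarrow> a \<in> A \<Longrightarrow> adj a v \<and> adj v a"
  by (auto simp: common_nbrs_def insert_commute)

lemma N_disjoint: "A \<inter> N A = {}"
  using not_adj_self in_N_adj by blast

text \<open>A list form of cycle-freeness, matching the paths produced as lists above.\<close>

lemma no_cycle:
  assumes "successively adj p" "distinct p" "length p = 2 * s + 2" "adj (last p) (hd p)"
  shows False
proof -
  let ?k = "2 * s + 2"
  have adj: "adj (p ! i) (p ! ((i + 1) mod ?k))" if "i < ?k" for i
  proof (cases "i + 1 < ?k")
    case True
    then show ?thesis
      using assms(1,3) by (simp add: successively_conv_nth)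
  next
    case False
    then have "i + 1 = ?k"
      using that by linarith
    then have "i = length p - 1" "(i + 1) mod ?k = 0"
      using assms(3) by simp_all
    moreover have "p \<noteq> []"
      using assms(3) by auto
    ultimately show ?thesis
      using assms(4) by (simp add: last_conv_nth hd_conv_nth)
  qed
  have "contains_copy G (cycle_graph ?k)"
  proof (rule contains_copyI[of _ _ "(!) p"])
    show "simple_graph (cycle_graph ?k)"
    proof -
      have "card {i, (i + 1) mod ?k} = 2" if "i < ?k" for i
      proof -
        have "(i + 1) mod ?k \<noteq> i"
          using that by (cases "i + 1 = ?k") auto
        then show ?thesis by auto
      qed
      then show ?thesis
        by (auto simp: simple_graph_def cycle_graph_def)
    qed
    show "inj_on ((!) p) (verts (cycle_graph ?k))"
      using assms by (auto simp: cycle_graph_def inj_on_def nth_eq_iff_index_eq)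
    show "(!) p ` verts (cycle_graph ?k) \<subseteq> V"
      using adj adj_verts by (auto simp: cycle_graph_def)
    show "(!) p ` e \<in> edges G" if "e \<in> edges (cycle_graph ?k)" for e
      using that adj by (auto simp: cycle_graph_def)
  qed (fact simple)
  then show False
    using cycle_free by simp
qed

text \<open>Otherwise \<open>S\<close> together with \<open>s + 1\<close> common neighbours,
  \<open>u\<close> and \<open>u'\<close> among them, carries a spanning path from \<open>u\<close>
  to \<open>u'\<close> on \<open>2 * s + 1\<close> vertices that avoids \<open>v\<close>; closing it
  through \<open>v\<close> gives the forbidden cycle.\<close>

lemma rich_two_nbrs:
  assumes "rich S" "v \<notin> S" "u \<in> N S" "u' \<in> N S" "adj v u" "adj v u'"
  shows "u = u'"
proof (rule ccontr)
  assume "u \<noteq> u'"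
  have finS: "finite S" and cS: "card S = s"
    using assms(1) finV finite_subset by (auto simp: rich_def)
  have "card (N S - {v, u, u'}) \<ge> s - 1"
  proof -
    have "card (N S - {v, u, u'}) \<ge> card (N S) - card {v, u, u'}"
      by (simp add: diff_card_le_card_Diff)
    moreover have "card {v, u, u'} \<le> 3"
      by (simp add: card_insert_le_m1)
    moreover have "s + 2 \<le> card (N S)"
      using assms(1) by (simp add: rich_def)
    ultimately show ?thesis
      by linarith
  qed
  then obtain T where T: "T \<subseteq> N S - {v, u, u'}" "card T = s - 1"
    by (meson obtain_subset_with_card_n)
  have "finite T"
    using T(1) finN by (meson Diff_subset finite_subset)
  let ?Y = "insert u (insert u' T)"
  have "u \<notin> T" "u' \<notin> T"
    using T(1) by auto
  then have cY: "card ?Y = s + 1"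
    using T(2) \<open>finite T\<close> \<open>u \<noteq> u'\<close> s3 by simp
  have "\<exists>p. p \<noteq> [] \<and> hd p = u \<and> last p = u' \<and> distinct p \<and> set p = S \<union> ?Y \<and> successively adj p"
  proof (rule path_in_biclique_same_side)
    show "S \<inter> ?Y = {}"
      using N_disjoint[of S] T(1) assms by auto
    show "card ?Y = Suc (card S)"
      using cY cS by simp
    show "adj a b \<and> adj b a" if "a \<in> S" "b \<in> ?Y" for a b
      using that T(1) assms in_N_adj by blast
  qed (use finS \<open>finite T\<close> \<open>u \<noteq> u'\<close> in auto)
  then obtain p where p: "p \<noteq> []" "hd p = u" "last p = u'" "distinct p" "set p = S \<union> ?Y" "successively adj p"
    by blast
  have "v \<notin> set p"
    using p(5) assms T(1) not_adj_self by blast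
  moreover have "length p = 2 * s + 1"
  proof -
    have "length p = card (S \<union> ?Y)"
      using p distinct_card by metis
    also have "\<dots> = card S + card ?Y"
      using N_disjoint[of S] T(1) assms finS \<open>finite T\<close> by (intro card_Un_disjoint) auto
    also note cY
    finally show ?thesis
      using cS by simp
  qed
  ultimately show False
    using p assms adj_commute[of v u'] by (intro no_cycle[of "v # p"]) (auto simp: successively_Cons)
qed

text \<open>Two different edges inside \<open>N S\<close> can be joined through some
  \<open>z\<close> in \<open>S\<close> to the path \<open>a, a', z, b, b'\<close>. A path
  alternating between \<open>S - {z}\<close> and \<open>s - 2\<close> further common neighbours has
  \<open>2 * s - 3\<close> vertices and closes it to a cycle of length
  \<open>2 * s + 2\<close>.\<close>

lemma rich_single_edge:
  assumes "rich S" "a \<in> N S" "a' \<in> N S" "b \<in> N S" "b' \<in> N S" "adj a a'" "adj b b'"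
  shows "{a, a'} = {b, b'}"
proof (rule ccontr)
  assume neq: "{a, a'} \<noteq> {b, b'}"
  have out: "x \<notin> S" if "x \<in> N S" for x
    using that N_disjoint by blast
  \<comment> \<open>If the two edges shared an end, that vertex, lying outside \<open>S\<close>,
    would have two neighbours in \<open>N S\<close>, against \<open>rich_two_nbrs\<close>.\<close>
  have dist: "distinct [a, a', b, b']"
    using neq rich_two_nbrs[OF assms(1), OF out] assms not_adj_self adj_commute
    by (smt (verit) distinct_length_2_or_more distinct_singleton insert_commute)
  have finS: "finite S" and cS: "card S = s"
    using assms(1) finV finite_subset by (auto simp: rich_def)
  have "card (N S - {a, a', b, b'}) \<ge> card (N S) - card {a, a', b, b'}"
    by (simp add: diff_card_le_card_Diff)
  moreover have "card {a, a', b, b'} = 4" "s + 2 \<le> card (N S)"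
    using assms(1) dist by (simp_all add: rich_def)
  ultimately have "card (N S - {a, a', b, b'}) \<ge> s - 2"
    by linarith
  then obtain T where T: "T \<subseteq> N S - {a, a', b, b'}" "card T = s - 2"
    by (meson obtain_subset_with_card_n)
  have "finite T"
    using T(1) finN by (meson Diff_subset finite_subset)
  have "S \<noteq> {}"
    using cS s3 by auto
  then obtain z where z: "z \<in> S" by blast
  have "card (S - {z}) = s - 1"
    using z cS finS by simp
  then have "2 \<le> card (S - {z})"
    using s3 by linarith
  then obtain W where "W \<subseteq> S - {z}" "card W = 2"
    by (meson obtain_subset_with_card_n)
  then obtain x y where xy: "x \<in> S - {z}" "y \<in> S - {z}" "x \<noteq> y"
    by (auto simp: card_2_iff)
  have "\<exists>p. p \<noteq> [] \<and> hd p = x \<and> last p = y \<and> distinct p \<and> set p = T \<union> (S - {z}) \<and> successively adj p"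
  proof (rule path_in_biclique_same_side)
    show "T \<inter> (S - {z}) = {}"
      using N_disjoint[of S] T(1) by auto
    show "card (S - {z}) = Suc (card T)"
      using z cS finS T s3 by simp
    show "adj u v \<and> adj v u" if "u \<in> T" "v \<in> S - {z}" for u v
      using that T(1) in_N_adj by blast
  qed (use finS \<open>finite T\<close> xy in auto)
  then obtain p where p: "p \<noteq> []" "hd p = x" "last p = y" "distinct p" "set p = T \<union> (S - {z})"
    "successively adj p" by blast
  have "length p = card (T \<union> (S - {z}))"
    using p distinct_card by metis
  also have "\<dots> = card T + card (S - {z})"
    using N_disjoint[of S] T(1) finS \<open>finite T\<close> by (intro card_Un_disjoint) auto
  finally have len: "length p = 2 * s - 3"
    using T cS z finS s3 by simp
  show False
  proof (rule no_cycle[of "[a, a', z, b, b'] @ p"])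
    show "successively adj ([a, a', z, b, b'] @ p)"
      using p xy z assms in_N_adj[of _ S] by (auto simp: successively_Cons)
    show "distinct ([a, a', z, b, b'] @ p)"
      using p dist z T(1) assms out by (auto simp: subset_iff)
    show "length ([a, a', z, b, b'] @ p) = 2 * s + 2"
      using len s3 by simp
    show "adj (last ([a, a', z, b, b'] @ p)) (hd ([a, a', z, b, b'] @ p))"
      using p xy assms in_N_adj[of a S] by auto
  qed
qed

end

subsection \<open>Copies without a rich side\<close>

text \<open>These are the two types of cliques in a Johnson graph. If some \<open>T\<close> in the
  family misses a point \<open>z\<close> of \<open>P \<inter> P'\<close>, then
  \<open>T = P \<union> P' - {z}\<close>, and the three sets \<open>P\<close>, \<open>P'\<close>,
  \<open>T\<close> leave no room for a member reaching outside \<open>P \<union> P'\<close>.\<close>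

lemma large_intersections_cases:
  assumes card: "\<And>P. P \<in> F \<Longrightarrow> finite P \<and> card P = Suc k"
    and inter: "\<And>P P'. P \<in> F \<Longrightarrow> P' \<in> F \<Longrightarrow> k \<le> card (P \<inter> P')"
  obtains (subset) L where "finite L" "card L \<le> Suc (Suc k)" "\<forall>P\<in>F. P \<subseteq> L"
  | (superset) P P' where "P \<in> F" "P' \<in> F" "card (P \<inter> P') = k" "\<forall>Q\<in>F. P \<inter> P' \<subseteq> Q"
proof (cases "\<exists>P\<in>F. \<exists>P'\<in>F. P \<noteq> P'")
  case False
  show ?thesis
  proof (cases "F = {}")
    case True
    then show ?thesis
      by (intro subset[of "{}"]) auto
  next
    case False
    then obtain P where "P \<in> F" by blast
    with \<open>\<not> (\<exists>P\<in>F. \<exists>P'\<in>F. P \<noteq> P')\<close> show ?thesis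
      using card[of P] by (intro subset[of P]) auto
  qed
next
  case True
  then obtain P P' where P: "P \<in> F" "P' \<in> F" "P \<noteq> P'" by blast
  have inter_eq: "card (Q \<inter> Q') = k" if "Q \<in> F" "Q' \<in> F" "Q \<noteq> Q'" for Q Q'
  proof -
    have "\<not> Q \<subseteq> Q'"
      using that card card_subset_eq by metis
    then have "card (Q \<inter> Q') < card Q"
      using card[OF that(1)] by (intro psubset_card_mono) auto
    then show ?thesis
      using card[OF that(1)] inter[OF that(1,2)] by linarith
  qed
  show ?thesis
  proof (cases "\<forall>Q\<in>F. P \<inter> P' \<subseteq> Q")
    case True
    then show ?thesis
      using P inter_eq superset by blast
  next
    case False
    then obtain T z where T: "T \<in> F" "z \<in> P" "z \<in> P'" "z \<notin> T" by blast
    have fin: "finite P" "finite P'" "finite T"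
      using card P T by auto
    have ne: "T \<noteq> P" "T \<noteq> P'"
      using T by auto
    have sub: "P - {z} \<subseteq> T" if "P \<in> F" "z \<in> P" for P
    proof -
      have "card (T \<inter> P) = k" "finite P" "card (P - {z}) = k"
        using that T inter_eq card by auto
      moreover have "T \<inter> P \<subseteq> P - {z}"
        using T by blast
      ultimately have "T \<inter> P = P - {z}"
        by (intro card_subset_eq) auto
      then show ?thesis by blast
    qed
    have cL: "card (P \<union> P') = Suc (Suc k)"
    proof -
      have "card P + card P' = card (P \<union> P') + card (P \<inter> P')"
        using fin by (intro card_Un_Int)
      then show ?thesis
        using inter_eq[OF P] card P by simp
    qed
    have T_eq: "T = P \<union> P' - {z}"
    proof -
      have "card (P \<union> P' - {z}) = card T"
        using cL T card fin by simp
      moreover have "P \<union> P' - {z} \<subseteq> T"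
        using sub P T by blast
      ultimately show ?thesis
        using fin card_subset_eq by metis
    qed
    have "U \<subseteq> P \<union> P'" if "U \<in> F" for U
    proof (rule ccontr)
      assume "\<not> U \<subseteq> P \<union> P'"
      then obtain u where u: "u \<in> U" "u \<notin> P \<union> P'" by blast
      have U: "finite U" "card (U - {u}) = k"
        using card[OF that] u by auto
      have sub': "U - {u} \<subseteq> X" if "X \<in> F" "X \<subseteq> P \<union> P'" for X
      proof -
        have "U \<noteq> X"
          using u that by blast
        then have "card (U \<inter> X) = card (U - {u})"
          using inter_eq[OF \<open>U \<in> F\<close> that(1)] U by simp
        moreover have "U \<inter> X \<subseteq> U - {u}"
          using u that by blast
        ultimately have "U \<inter> X = U - {u}"
          using U by (intro card_subset_eq) auto
        then show ?thesis by blast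
      qed
      \<comment> \<open>The \<open>k\<close> points of \<open>U - {u}\<close> would have to lie in
        all of \<open>P\<close>, \<open>P'\<close> and \<open>T\<close>, whose intersection has
        fewer than \<open>k\<close> points.\<close>
      have "U - {u} \<subseteq> P \<inter> P' - {z}"
        using sub'[of P] sub'[of P'] sub'[of T] P T T_eq by blast
      then have "k \<le> card (P \<inter> P' - {z})"
        using U fin card_mono by (metis finite_Diff finite_Int)
      also have "\<dots> < card (P \<inter> P')"
        using T fin by (intro psubset_card_mono) auto
      finally show False
        using inter_eq[OF P] by simp
    qed
    then show ?thesis
      using cL fin by (intro subset[of "P \<union> P'"]) auto
  qed
qed

section \<open>Copies sharing an edge, and their number at one edge\<close>

context even_cycle_free
begin

text \<open>The pairs are ordered: each copy arises both from \<open>(A, B)\<close> and from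
  \<open>(B, A)\<close>.\<close>

definition sides :: "('a set \<times> 'a set) set" where
  "sides = {(A, B). A \<subseteq> V \<and> card A = s \<and> B \<subseteq> N A \<and> card B = s}"

definition poor_sides :: "('a set \<times> 'a set) set" where
  "poor_sides = {(A, B) \<in> sides. \<not> rich A \<and> \<not> rich B}"

lemma sidesD:
  assumes "(A, B) \<in> sides"
  shows "A \<subseteq> V" "B \<subseteq> V" "finite A" "finite B" "card A = s" "card B = s" "B \<subseteq> N A" "A \<subseteq> N B"
    "A \<inter> B = {}" "\<And>a b. a \<in> A \<Longrightarrow> b \<in> B \<Longrightarrow> adj a b \<and> adj b a"
proof -
  show *: "A \<subseteq> V" "card A = s" "card B = s" "B \<subseteq> N A"
    using assms by (auto simp: sides_def)
  show "B \<subseteq> V"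
    using * N_subset by blast
  show "finite A" "finite B"
    using * N_subset finV by (metis finite_subset subset_trans)+
  show "A \<subseteq> N B"
  proof
    fix x assume "x \<in> A"
    then have "\<forall>b\<in>B. adj b x" "x \<in> V"
      using * in_N_adj by blast+
    then show "x \<in> N B"
      by (simp add: common_nbrs_def)
  qed
  show "A \<inter> B = {}"
    using * N_disjoint[of A] by blast
  show "adj a b \<and> adj b a" if "a \<in> A" "b \<in> B" for a b
    using that * in_N_adj by blast
qed

lemma sides_swap:
  assumes "(A, B) \<in> sides" shows "(B, A) \<in> sides"
  using sidesD(2,5,6,8)[OF assms] unfolding sides_def by blast

lemma poor_sides_swap: "(A, B) \<in> poor_sides \<Longrightarrow> (B, A) \<in> poor_sides"
  by (simp add: poor_sides_def sides_swap)

lemma poor_sidesD: "(A, B) \<in> poor_sides \<Longrightarrow> (A, B) \<in> sides \<and> \<not> rich A \<and> \<not> rich B"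
  by (auto simp: poor_sides_def)

lemma finite_sides: "finite sides"
proof (rule finite_subset)
  show "sides \<subseteq> Pow V \<times> Pow V"
  proof
    fix q assume "q \<in> sides"
    then show "q \<in> Pow V \<times> Pow V"
      using sidesD(1,2)[of "fst q" "snd q"] by (cases q) simp
  qed
qed (use finV in simp)

lemma poor_common_nbrs_le: "(A, B) \<in> poor_sides \<Longrightarrow> card (N A) \<le> s + 1"
  by (auto simp: poor_sides_def sides_def rich_def)

lemma card_sides_Un:
  assumes "(A, B) \<in> sides" shows "card (A \<union> B) = 2 * s"
  using sidesD(3,4,5,6,9)[OF assms] by (simp add: card_Un_disjoint)

text \<open>Both new vertices are adjacent to all of \<open>B2\<close>, which lies inside the first
  copy. For a suitable \<open>u\<close> in \<open>B2\<close>, the path \<open>a, u, a'\<close>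
  closes up with a spanning path of the first copy minus \<open>u\<close> between two vertices of
  \<open>B2\<close>, giving \<open>3 + (2 * s - 1)\<close> vertices.\<close>

lemma no_two_new_on_one_side:
  assumes 1: "(A1, B1) \<in> poor_sides" and 2: "(A2, B2) \<in> sides"
    and sub: "B2 \<subseteq> A1 \<union> B1" and meet: "B2 \<inter> B1 \<noteq> {}"
    and a: "a \<in> A2 - (A1 \<union> B1)" "a' \<in> A2 - (A1 \<union> B1)" "a \<noteq> a'"
  shows False
proof -
  note S1 = sidesD[OF poor_sidesD[OF 1, THEN conjunct1]] and S2 = sidesD[OF 2]
  \<comment> \<open>Otherwise \<open>A1\<close>, \<open>a\<close> and \<open>a'\<close> give
    \<open>B1\<close> at least \<open>s + 2\<close> common neighbours, so \<open>B1\<close> would be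
    rich.\<close>
  have "B2 \<noteq> B1"
  proof
    assume "B2 = B1"
    then have "insert a (insert a' A1) \<subseteq> N B1"
      using S1(8) S2(8) a by blast
    then have "card (insert a (insert a' A1)) \<le> card (N B1)"
      by (intro card_mono finN)
    also have "\<dots> \<le> s + 1"
      by (rule poor_common_nbrs_le[OF poor_sides_swap[OF 1]])
    finally show False
      using S1(3,5) a by simp
  qed
  then obtain z where z: "z \<in> B2" "z \<in> A1"
    using sub S1(4,6) S2(6) card_subset_eq[of B1 B2] by auto
  have close: False if p: "p \<noteq> []" "distinct p" "successively adj p" "hd p \<in> B2" "last p \<in> B2"
    "set p = (A1 \<union> B1) - {u}" and u: "u \<in> B2" "u \<in> A1 \<union> B1" for p u
  proof (rule no_cycle[of "a # u # a' # p"])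
    show "successively adj (a # u # a' # p)"
      using p(1,3,4) u(1) a by (simp add: successively_Cons S2(10))
    show "distinct (a # u # a' # p)"
      using p u a by auto
    have "length p = card (A1 \<union> B1 - {u})"
      using p distinct_card by metis
    also have "\<dots> = 2 * s - 1"
      using card_sides_Un[OF poor_sidesD[OF 1, THEN conjunct1]] S1(3,4) u(2) by simp
    finally show "length (a # u # a' # p) = 2 * s + 2"
      using s3 by simp
    show "adj (last (a # u # a' # p)) (hd (a # u # a' # p))"
      using p(1,5) a by (simp add: S2(10))
  qed
  have dis: "A1 \<inter> B1 = {}" by fact
  have "B2 = (B2 \<inter> A1) \<union> (B2 \<inter> B1)"
    using sub by blast
  then have "card B2 \<le> card (B2 \<inter> A1) + card (B2 \<inter> B1)"
    using card_Un_le[of "B2 \<inter> A1" "B2 \<inter> B1"] by simp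
  \<comment> \<open>The path must end on the side of the first copy not containing \<open>u\<close>,
    as that side is now larger by one. Since \<open>s \<ge> 3\<close>, one side contains two
    vertices of \<open>B2\<close> to serve as ends, and \<open>u\<close> is taken from the other
    side.\<close>
  then consider "2 \<le> card (B2 \<inter> A1)" | "2 \<le> card (B2 \<inter> B1)"
    using S2(6) s3 by linarith
  then show False
  proof cases
    case 1
    then obtain W where "W \<subseteq> B2 \<inter> A1" "card W = 2"
      by (meson obtain_subset_with_card_n)
    then obtain y y' where y: "y \<in> B2 \<inter> A1" "y' \<in> B2 \<inter> A1" "y \<noteq> y'"
      by (auto simp: card_2_iff)
    obtain u where u: "u \<in> B2 \<inter> B1"
      using meet by blast
    have "\<exists>p. p \<noteq> [] \<and> hd p = y \<and> last p = y' \<and> distinct p \<and> set p = (B1 - {u}) \<union> A1 \<and> successively adj p"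
      using S1(3-6,9,10) y u s3 by (intro path_in_biclique_same_side) auto
    moreover have "(B1 - {u}) \<union> A1 = (A1 \<union> B1) - {u}"
      using u dis by blast
    ultimately show ?thesis
      using close[of _ u] y u by (metis IntD1 IntD2 UnCI)
  next
    case 2
    then obtain W where "W \<subseteq> B2 \<inter> B1" "card W = 2"
      by (meson obtain_subset_with_card_n)
    then obtain y y' where y: "y \<in> B2 \<inter> B1" "y' \<in> B2 \<inter> B1" "y \<noteq> y'"
      by (auto simp: card_2_iff)
    have "\<exists>p. p \<noteq> [] \<and> hd p = y \<and> last p = y' \<and> distinct p \<and> set p = (A1 - {z}) \<union> B1 \<and> successively adj p"
      using S1(3-6,9,10) y z s3 by (intro path_in_biclique_same_side) auto
    moreover have "(A1 - {z}) \<union> B1 = (A1 \<union> B1) - {z}"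
      using z dis by blast
    ultimately show ?thesis
      using close[of _ z] y z by (metis IntD1 UnCI)
  qed
qed

text \<open>Otherwise the second copy has two vertices outside the first. If all new vertices are on
  one side, \<open>no_two_new_on_one_side\<close> applies; if there are new \<open>d\<close> in
  \<open>A2\<close> and \<open>e\<close> in \<open>B2\<close>, then \<open>d, e\<close> extends a
  spanning path of the first copy from \<open>x\<close> to \<open>y\<close> to a forbidden
  cycle.\<close>

lemma poor_sides_meet:
  assumes 1: "(A1, B1) \<in> poor_sides" and 2: "(A2, B2) \<in> poor_sides"
    and x: "x \<in> A1 \<inter> A2" and y: "y \<in> B1 \<inter> B2"
  shows "2 * s - 1 \<le> card ((A1 \<union> B1) \<inter> (A2 \<union> B2))"
proof (rule ccontr)
  assume less: "\<not> ?thesis"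
  have q: "(A1, B1) \<in> sides" "(A2, B2) \<in> sides"
    using poor_sidesD[OF 1] poor_sidesD[OF 2] by simp_all
  note S1 = sidesD[OF q(1)] and S2 = sidesD[OF q(2)]
  let ?D = "(A2 \<union> B2) - (A1 \<union> B1)"
  have "card (A2 \<union> B2) = card ((A1 \<union> B1) \<inter> (A2 \<union> B2)) + card ?D"
    using S2(3,4) card_Int_Diff[of "A2 \<union> B2" "A1 \<union> B1"] by (simp add: Int_commute)
  then have "2 \<le> card ?D"
    using less card_sides_Un[OF q(2)] s3 by linarith
  then obtain W where "W \<subseteq> ?D" "card W = 2"
    by (meson obtain_subset_with_card_n)
  then obtain a a' where a: "a \<in> ?D" "a' \<in> ?D" "a \<noteq> a'"
    by (auto simp: card_2_iff)
  show False
  proof (cases "B2 \<subseteq> A1 \<union> B1")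
    case True
    then show False
      using no_two_new_on_one_side[OF 1 q(2) True] a y by blast
  next
    case nB: False
    show False
    proof (cases "A2 \<subseteq> A1 \<union> B1")
      case True
      then show False
        using no_two_new_on_one_side[OF poor_sides_swap[OF 1] sides_swap[OF q(2)]] a x by blast
    next
      case False
      then obtain d e where d: "d \<in> A2" "d \<notin> A1 \<union> B1" and e: "e \<in> B2" "e \<notin> A1 \<union> B1"
        using nB by blast
      have "\<exists>p. p \<noteq> [] \<and> hd p = x \<and> last p = y \<and> distinct p \<and> set p = A1 \<union> B1 \<and> successively adj p"
        using S1(3-6,9,10) x y by (intro path_in_biclique) auto
      then obtain p where p: "p \<noteq> []" "hd p = x" "last p = y" "distinct p" "set p = A1 \<union> B1"
        "successively adj p" by blast
      have "length p = 2 * s"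
        using p distinct_card card_sides_Un[OF q(1)] by metis
      moreover have "d \<noteq> e"
        using d e S2(9) by blast
      moreover have "adj d e" "adj e x" "adj y d"
        using d e x y by (simp_all add: S2(10))
      ultimately show False
        using p d e by (intro no_cycle[of "d # e # p"]) (auto simp: successively_Cons)
    qed
  qed
qed

definition poor_copies :: "'a graph set" where
  "poor_copies = (\<lambda>(A, B). biclique A B) ` poor_sides"

lemma finite_poor_sides: "finite poor_sides"
  by (rule finite_subset[OF _ finite_sides]) (auto simp: poor_sides_def)

lemma finite_poor_copies: "finite poor_copies"
  unfolding poor_copies_def by (intro finite_imageI finite_poor_sides)

text \<open>Here \<open>A\<close> is \<open>K - B\<close> plus one vertex \<open>w\<close> outside
  \<open>K\<close>. The set \<open>B\<close> is given by an \<open>(s - 1)\<close>-subset of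
  \<open>K - {x, y}\<close>; as \<open>B\<close> is not rich, it has at most \<open>s + 1\<close>
  common neighbours, of which \<open>K - B\<close> uses \<open>s - 1\<close>, leaving at most two
  choices for \<open>w\<close>.\<close>

lemma card_poor_sides_core:
  assumes K: "finite K" "card K = 2 * s - 1" and xy: "x \<in> K" "y \<in> K" "x \<noteq> y"
  shows "card {(A, B). (A, B) \<in> poor_sides \<and> x \<in> A \<and> y \<in> B \<and> K \<subseteq> A \<union> B \<and> B \<subseteq> K}
    \<le> 2 * ((2 * s - 3) choose (s - 1))" (is "card ?X \<le> _")
proof -
  define I where "I = {B. B \<subseteq> K - {x, y} \<and> card B = s - 1}"
  \<comment> \<open>The default \<open>{}\<close> makes the bound 2 on \<open>card (D B)\<close>
    hold for every \<open>B\<close>; for the pairs counted here \<open>D\<close> is the true set of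
    candidates for \<open>w\<close>.\<close>
  define D where "D B = (if card (N (insert y B) - (K - insert y B)) \<le> 2
    then N (insert y B) - (K - insert y B) else {})" for B
  let ?h = "\<lambda>(B, w). (insert w (K - insert y B), insert y B)"
  have "card (K - {x, y}) = 2 * s - 3"
    using K xy by (simp add: card_Diff_subset)
  then have I: "finite I" "card I = (2 * s - 3) choose (s - 1)"
    using K(1) n_subsets[of "K - {x, y}" "s - 1"] unfolding I_def by simp_all
  have D: "finite (D B)" "card (D B) \<le> 2" for B
    using finN by (simp_all add: D_def)
  have "?X \<subseteq> ?h ` Sigma I D"
  proof (clarify)
    fix A B assume AB: "(A, B) \<in> poor_sides" "x \<in> A" "y \<in> B" "K \<subseteq> A \<union> B" "B \<subseteq> K"
    note q = poor_sidesD[OF AB(1), THEN conjunct1]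
    note S = sidesD[OF q]
    have "card (A \<union> B - K) = 1"
      using card_sides_Un[OF q] AB(4) K s3 by (simp add: card_Diff_subset)
    then obtain w where w: "A \<union> B - K = {w}"
      by (meson card_1_singletonE)
    have wA: "w \<in> A" "w \<notin> K"
      using w AB(5) by blast+
    have A: "A = insert w (K - B)"
      using w S(9) AB(4,5) by blast
    have BI: "B - {y} \<in> I"
      using AB S(4,6,9) unfolding I_def by auto
    have sub: "K - B \<subseteq> N B"
      using A S(8) by blast
    have "card (K - B) = s - 1"
      using K AB(5) S(4,6) by (simp add: card_Diff_subset)
    then have "card (N B - (K - B)) \<le> 2"
      using poor_common_nbrs_le[OF poor_sides_swap[OF AB(1)]] sub K(1) by (simp add: card_Diff_subset)
    then have "w \<in> D (B - {y})"
      using AB(3) wA S(8) unfolding D_def by (auto simp: insert_absorb)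
    then have "(B - {y}, w) \<in> Sigma I D"
      using BI by blast
    moreover have "(A, B) = ?h (B - {y}, w)"
      using A AB(3) by (simp add: insert_absorb)
    ultimately show "(A, B) \<in> ?h ` Sigma I D"
      by blast
  qed
  then have "card ?X \<le> card (?h ` Sigma I D)"
    using I(1) D(1) by (intro card_mono) auto
  also have "\<dots> \<le> card (Sigma I D)"
    using I(1) D(1) by (intro card_image_le) auto
  also have "\<dots> = (\<Sum>B\<in>I. card (D B))"
    using I(1) D(1) by simp
  also have "\<dots> \<le> (\<Sum>B\<in>I. 2)"
    using D(2) by (intro sum_mono)
  finally show ?thesis
    using I(2) by simp
qed

text \<open>The vertex sets of these pairs have size \<open>2 * s\<close> and pairwise share at
  least \<open>2 * s - 1\<close> vertices, so \<open>large_intersections_cases\<close> applies.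
  Inside \<open>2 * s + 1\<close> vertices one chooses \<open>A - {x}\<close> among
  \<open>2 * s - 1\<close> and then \<open>B - {y}\<close> among the remaining \<open>s\<close>; a
  common core of size \<open>2 * s - 1\<close> gives fewer pairs.\<close>

lemma card_poor_sides_at:
  "card {(A, B). (A, B) \<in> poor_sides \<and> x \<in> A \<and> y \<in> B} \<le> s * ((2 * s - 1) choose (s - 1))"
  (is "card ?X \<le> ?p")
proof (cases "?X = {}")
  case True
  then show ?thesis by (metis card.empty zero_le)
next
  case False
  then obtain A0 B0 where AB0: "(A0, B0) \<in> poor_sides" "x \<in> A0" "y \<in> B0" by blast
  then have "x \<noteq> y"
    using sidesD(9)[of A0 B0] poor_sidesD by blast
  define F where "F = (\<lambda>(A, B). A \<union> B) ` ?X"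
  have in_F: "A \<union> B \<in> F" if "(A, B) \<in> poor_sides" "x \<in> A" "y \<in> B" for A B
    unfolding F_def using that by (intro rev_image_eqI[of "(A, B)"]) auto
  have card: "finite P \<and> card P = Suc (2 * s - 1)" if P: "P \<in> F" for P
  proof -
    obtain A B where "(A, B) \<in> sides" "P = A \<union> B"
      using P poor_sidesD unfolding F_def by blast
    then show ?thesis
      using card_sides_Un[of A B] sidesD(3,4)[of A B] s3 by simp
  qed
  have inter: "2 * s - 1 \<le> card (P \<inter> P')" if P: "P \<in> F" "P' \<in> F" for P P'
  proof -
    obtain A B where AB: "(A, B) \<in> poor_sides" "x \<in> A" "y \<in> B" "P = A \<union> B"
      using P(1) unfolding F_def by blast
    obtain A' B' where AB': "(A', B') \<in> poor_sides" "x \<in> A'" "y \<in> B'" "P' = A' \<union> B'"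
      using P(2) unfolding F_def by blast
    show ?thesis
      using poor_sides_meet[OF AB(1) AB'(1)] AB AB' by blast
  qed
  show ?thesis
  proof (cases rule: large_intersections_cases[of F "2 * s - 1", case_names size meet subset superset])
    case (size P)
    then show ?case by (rule card)
  next
    case (meet P P')
    then show ?case by (rule inter)
  next
    case (subset L)
    have sub: "A \<union> B \<subseteq> L" if "(A, B) \<in> poor_sides" "x \<in> A" "y \<in> B" for A B
      using subset(3) in_F[OF that] by blast
    define I where "I = {A. A \<subseteq> L - {x, y} \<and> card A = s - 1}"
    define J where "J A = {B. B \<subseteq> L - {x, y} - A \<and> card B = s - 1}" for A
    let ?h = "\<lambda>(A, B). (insert x A, insert y B)"
    have "card (L - {x, y}) \<le> 2 * s - 1"
      using subset(1,2) sub[OF AB0] AB0 \<open>x \<noteq> y\<close> s3 by (subst card_Diff_subset) auto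
    then have I: "finite I" "card I \<le> (2 * s - 1) choose (s - 1)"
      using subset(1) n_subsets[of "L - {x, y}" "s - 1"] binomial_right_mono unfolding I_def by simp_all
    have J: "finite (J A)" "card (J A) \<le> s" if "A \<in> I" for A
    proof -
      have "A \<subseteq> L"
        using that unfolding I_def by auto
      then have "finite A"
        using subset(1) by (rule finite_subset)
      then have "card (L - {x, y} - A) \<le> s"
        using that \<open>card (L - {x, y}) \<le> 2 * s - 1\<close> s3 unfolding I_def by (simp add: card_Diff_subset)
      then have "(card (L - {x, y} - A)) choose (s - 1) \<le> s choose (s - 1)"
        by (rule binomial_right_mono)
      also have "\<dots> = s"
        using s3 binomial_symmetric[of 1 s] by simp
      finally show "card (J A) \<le> s"
        using subset(1) n_subsets[of "L - {x, y} - A" "s - 1"] unfolding J_def by simp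
      show "finite (J A)"
        using subset(1) unfolding J_def by simp
    qed
    have "?X \<subseteq> ?h ` Sigma I J"
    proof clarify
      fix A B assume AB: "(A, B) \<in> poor_sides" "x \<in> A" "y \<in> B"
      note S = sidesD[OF poor_sidesD[OF AB(1), THEN conjunct1]]
      have "A - {x} \<in> I"
        using AB S(3,5,9) sub[OF AB] unfolding I_def by auto
      moreover have "B - {y} \<in> J (A - {x})"
        using AB S(4,6,9) sub[OF AB] unfolding J_def by auto
      ultimately have "(A - {x}, B - {y}) \<in> Sigma I J"
        by simp
      then show "(A, B) \<in> ?h ` Sigma I J"
        by (rule rev_image_eqI) (use AB in \<open>simp add: insert_absorb\<close>)
    qed
    then have "card ?X \<le> card (?h ` Sigma I J)"
      using I(1) J(1) by (intro card_mono) auto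
    also have "\<dots> \<le> card (Sigma I J)"
      using I(1) J(1) by (intro card_image_le) auto
    also have "\<dots> = (\<Sum>A\<in>I. card (J A))"
      using I(1) J(1) by simp
    also have "\<dots> \<le> (\<Sum>A\<in>I. s)"
      using J(2) by (intro sum_mono)
    also have "\<dots> \<le> ?p"
      using I(2) by simp
    finally show ?thesis .
  next
    case (superset P P')
    define K where "K = P \<inter> P'"
    have "x \<in> P \<and> y \<in> P" if "P \<in> F" for P
      using that unfolding F_def by auto
    then have K: "finite K" "card K = 2 * s - 1" "x \<in> K" "y \<in> K"
      using superset(1-3) card[of P] unfolding K_def by auto
    let ?X1 = "{(A, B). (A, B) \<in> poor_sides \<and> x \<in> A \<and> y \<in> B \<and> K \<subseteq> A \<union> B \<and> B \<subseteq> K}"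
    let ?X2 = "{(A, B). (A, B) \<in> poor_sides \<and> y \<in> A \<and> x \<in> B \<and> K \<subseteq> A \<union> B \<and> B \<subseteq> K}"
    have fin: "finite ?X1" "finite ?X2"
      using finite_poor_sides by (auto intro: finite_subset[rotated])
    have "?X \<subseteq> ?X1 \<union> prod.swap ` ?X2"
    proof
      fix q' assume "q' \<in> ?X"
      then obtain A B where q': "q' = (A, B)" and AB: "(A, B) \<in> poor_sides" "x \<in> A" "y \<in> B"
        by auto
      note q = poor_sidesD[OF AB(1), THEN conjunct1]
      have sub: "K \<subseteq> A \<union> B"
        using superset(4) in_F[OF AB(1-3)] unfolding K_def by blast
      \<comment> \<open>The only vertex outside \<open>K\<close> lies on just one side, so the other
        side is inside \<open>K\<close>; exchanging the sides, and with them \<open>x\<close> and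
        \<open>y\<close>, reduces \<open>A \<subseteq> K\<close> to
        \<open>B \<subseteq> K\<close>.\<close>
      have "card (A \<union> B - K) = 1"
        using card_sides_Un[OF q] sub K s3 by (simp add: card_Diff_subset)
      then obtain w where w: "A \<union> B - K = {w}"
        by (meson card_1_singletonE)
      then have "A \<union> B \<subseteq> insert w K"
        by auto
      moreover have "w \<notin> A \<or> w \<notin> B"
        using sidesD(9)[OF q] by auto
      ultimately consider "B \<subseteq> K" | "A \<subseteq> K"
        by auto
      then show "q' \<in> ?X1 \<union> prod.swap ` ?X2"
      proof cases
        case 1
        then show ?thesis
          using AB sub q' by simp
      next
        case 2
        then have "(B, A) \<in> ?X2"
          using AB(2,3) poor_sides_swap[OF AB(1)] sub by auto
        then have "q' \<in> prod.swap ` ?X2"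
          by (rule rev_image_eqI) (simp add: q')
        then show ?thesis by blast
      qed
    qed
    then have "card ?X \<le> card (?X1 \<union> prod.swap ` ?X2)"
      using fin by (intro card_mono) auto
    also have "\<dots> \<le> card ?X1 + card (prod.swap ` ?X2)"
      by (rule card_Un_le)
    also have "\<dots> \<le> card ?X1 + card ?X2"
      using card_image_le[OF fin(2)] by simp
    also have "\<dots> \<le> 4 * ((2 * s - 3) choose (s - 1))"
      using card_poor_sides_core[OF K \<open>x \<noteq> y\<close>]
        card_poor_sides_core[OF K(1,2,4,3) \<open>x \<noteq> y\<close>[symmetric]] by linarith
    \<comment> \<open>With \<open>s = t + 2\<close>, symmetry and Pascal's rule give \<open>2 * ((2
      * t + 1) choose (t + 1)) = (2 * t + 2) choose (t + 1)\<close>, and the other factor 2 is at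
      most \<open>s\<close>.\<close>
    also have "\<dots> \<le> ?p"
    proof -
      obtain t where t: "s = t + 2"
        using s3 le_Suc_ex[of 2 s] by auto
      have "(2 * t + 1) choose (t + 1) = (2 * t + 1) choose t"
        using binomial_symmetric[of t "2 * t + 1"] by simp
      moreover have "(2 * t + 3) choose (t + 1) \<ge> (2 * t + 2) choose (t + 1)"
        by (intro binomial_right_mono) simp
      ultimately have "2 * ((2 * t + 1) choose (t + 1)) \<le> (2 * t + 3) choose (t + 1)"
        using binomial_Suc_Suc[of "2 * t + 1" t] by simp
      then have "2 * (2 * ((2 * t + 1) choose (t + 1))) \<le> s * ((2 * t + 3) choose (t + 1))"
        using t by (intro mult_le_mono) auto
      moreover have "2 * s - 3 = 2 * t + 1" "s - 1 = t + 1" "2 * s - 1 = 2 * t + 3"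
        using t by simp_all
      ultimately show ?thesis by simp
    qed
    finally show ?thesis .
  qed
qed

text \<open>Passing from ordered pairs to copies costs no factor: each copy containing
  \<open>{x, y}\<close> can be oriented with \<open>x\<close> on the first side.\<close>

lemma poor_copies_at_edge:
  "card {Q \<in> poor_copies. e \<in> edges Q} \<le> s * ((2 * s - 1) choose (s - 1))" (is "card ?X \<le> ?p")
proof (cases "?X = {}")
  case True
  then show ?thesis by (metis card.empty zero_le)
next
  case False
  then obtain x y where e: "e = {x, y}"
    by (auto simp: poor_copies_def biclique_def)
  let ?Y = "{(A, B). (A, B) \<in> poor_sides \<and> x \<in> A \<and> y \<in> B}"
  have fin: "finite ?Y"
    using finite_poor_sides by (auto intro: finite_subset[rotated])
  have "?X \<subseteq> (\<lambda>(A, B). biclique A B) ` ?Y"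
  proof
    fix Q assume "Q \<in> ?X"
    then obtain A B where AB: "(A, B) \<in> poor_sides" and Q: "Q = biclique A B" and "e \<in> edges Q"
      unfolding poor_copies_def by auto
    with e have "x \<in> A \<and> y \<in> B \<or> x \<in> B \<and> y \<in> A"
      by (auto simp: biclique_def doubleton_eq_iff)
    then show "Q \<in> (\<lambda>(A, B). biclique A B) ` ?Y"
    proof
      assume "x \<in> A \<and> y \<in> B"
      with AB have "(A, B) \<in> ?Y" by simp
      then show ?thesis unfolding Q by (rule rev_image_eqI) simp
    next
      assume "x \<in> B \<and> y \<in> A"
      with poor_sides_swap[OF AB] have "(B, A) \<in> ?Y" by simp
      then show ?thesis unfolding Q by (rule rev_image_eqI) (simp add: biclique_commute)
    qed
  qed
  then have "card ?X \<le> card ((\<lambda>(A, B). biclique A B) ` ?Y)"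
    using fin by (intro card_mono) auto
  also have "\<dots> \<le> card ?Y"
    by (rule card_image_le[OF fin])
  also have "\<dots> \<le> ?p"
    by (rule card_poor_sides_at)
  finally show ?thesis .
qed

text \<open>Double counting of pairs of a copy in \<open>X\<close> and an edge of it inside
  \<open>W\<close>: each copy has at least \<open>q\<close> such edges, and each of the
  \<open>card W choose 2\<close> pairs lies in a bounded number of copies.\<close>

lemma poor_copies_le:
  assumes W: "W \<subseteq> V" and X: "X \<subseteq> poor_copies"
    and q: "\<And>A B. (A, B) \<in> poor_sides \<Longrightarrow> biclique A B \<in> X \<Longrightarrow> q \<le> card (A \<inter> W) * card (B \<inter> W)"
  shows "q * card X \<le> s * ((2 * s - 1) choose (s - 1)) * (card W choose 2)"
proof -
  let ?E = "{e. e \<subseteq> W \<and> card e = 2}"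
  have finW: "finite W" and finE: "finite ?E" and finX: "finite X"
  proof -
    show "finite W"
      by (rule finite_subset[OF W finV])
    then show "finite ?E"
      by simp
    show "finite X"
      by (rule finite_subset[OF X finite_poor_copies])
  qed
  have "q \<le> card {e \<in> ?E. e \<in> edges Q}" if Q: "Q \<in> X" for Q
  proof -
    obtain A B where AB: "(A, B) \<in> poor_sides" and QAB: "Q = biclique A B"
      using Q X by (auto simp: poor_copies_def)
    note S = sidesD[OF poor_sidesD[OF AB, THEN conjunct1]]
    have "{{a, b} |a b. a \<in> A \<inter> W \<and> b \<in> B \<inter> W} \<subseteq> {e \<in> ?E. e \<in> edges Q}"
    proof
      fix e assume "e \<in> {{a, b} |a b. a \<in> A \<inter> W \<and> b \<in> B \<inter> W}"
      then obtain a b where ab: "e = {a, b}" "a \<in> A" "a \<in> W" "b \<in> B" "b \<in> W"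
        by blast
      then have "a \<noteq> b"
        using S(9) by blast
      then show "e \<in> {e \<in> ?E. e \<in> edges Q}"
        using ab unfolding QAB biclique_def by auto
    qed
    then have "card {{a, b} |a b. a \<in> A \<inter> W \<and> b \<in> B \<inter> W} \<le> card {e \<in> ?E. e \<in> edges Q}"
      by (intro card_mono finite_subset[OF _ finE]) auto
    moreover have "card {{a, b} |a b. a \<in> A \<inter> W \<and> b \<in> B \<inter> W} = card (A \<inter> W) * card (B \<inter> W)"
      using S(3,4,9) by (intro card_pair_edges) auto
    ultimately show ?thesis
      using q[OF AB] Q QAB by simp
  qed
  then have "q * card X \<le> (\<Sum>Q\<in>X. card {e \<in> ?E. e \<in> edges Q})"
    using sum_mono[of X "\<lambda>_. q" "\<lambda>Q. card {e \<in> ?E. e \<in> edges Q}"] by (simp add: mult.commute)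
  also have "\<dots> = (\<Sum>e\<in>?E. card {Q \<in> X. e \<in> edges Q})"
    by (rule sum_multicount_gen[OF finX finE]) simp
  also have "\<dots> \<le> (\<Sum>e\<in>?E. s * ((2 * s - 1) choose (s - 1)))"
  proof (rule sum_mono)
    fix e
    have "card {Q \<in> X. e \<in> edges Q} \<le> card {Q \<in> poor_copies. e \<in> edges Q}"
      using X finite_poor_copies by (intro card_mono) auto
    then show "card {Q \<in> X. e \<in> edges Q} \<le> s * ((2 * s - 1) choose (s - 1))"
      using poor_copies_at_edge le_trans by blast
  qed
  also have "\<dots> = s * ((2 * s - 1) choose (s - 1)) * (card W choose 2)"
    using n_subsets[OF finW] by simp
  finally show ?thesis .
qed

section \<open>Rich sets have nearly disjoint common neighbourhoods\<close>

lemma rich_common_nbrs_Int: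
  assumes "rich S" "rich S'" "S \<noteq> S'"
  shows "card (N S \<inter> N S') \<le> 1"
proof -
  have "finite S" "card S = card S'"
    using assms(1,2) finV finite_subset by (auto simp: rich_def)
  then have "\<not> S' \<subseteq> S"
    using assms(3) card_subset_eq[of S S'] by auto
  then obtain v where v: "v \<in> S'" "v \<notin> S"
    by auto
  have "u = u'" if "u \<in> N S \<inter> N S'" "u' \<in> N S \<inter> N S'" for u u'
    using rich_two_nbrs[OF assms(1) v(2), of u u'] in_N_adj[OF _ v(1)] that by simp
  then show ?thesis
    using finN by (simp add: card_le_Suc0_iff_eq)
qed

text \<open>Some vertex of \<open>B\<close> lies outside \<open>S\<close> and is adjacent to all of
  \<open>A\<close>, so \<open>rich_two_nbrs\<close> applies to it.\<close>

lemma sides_meet_rich: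
  assumes "rich S" "(A, B) \<in> sides" "B \<noteq> S"
  shows "card (A \<inter> N S) \<le> 1"
proof -
  note Q = sidesD[OF assms(2)]
  have "finite S" "card S = card B"
    using assms(1) finV finite_subset Q(6) by (auto simp: rich_def)
  then have "\<not> B \<subseteq> S"
    using assms(3) card_subset_eq[of S B] by auto
  then obtain v where v: "v \<in> B" "v \<notin> S"
    by auto
  have "u = u'" if "u \<in> A \<inter> N S" "u' \<in> A \<inter> N S" for u u'
    using rich_two_nbrs[OF assms(1) v(2), of u u'] Q(10)[OF _ v(1)] that by simp
  then show ?thesis
    using finN by (simp add: card_le_Suc0_iff_eq)
qed

lemma finite_rich: "finite {S. rich S}"
  by (rule finite_subset[of _ "Pow V"]) (auto simp: rich_def finV)

text \<open>No pair of vertices lies in \<open>N S\<close> for two different rich \<open>S\<close>,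
  so these families of pairs pack into the pairs of \<open>V\<close>.\<close>

lemma sum_rich_pairs: "(\<Sum>S | rich S. card (N S) choose 2) \<le> card V choose 2"
proof -
  let ?P = "\<lambda>S. {e. e \<subseteq> N S \<and> card e = 2}"
  have "(\<Sum>S | rich S. card (N S) choose 2) = (\<Sum>S | rich S. card (?P S))"
    using n_subsets[OF finN] by simp
  also have "\<dots> = card (\<Union>S\<in>{S. rich S}. ?P S)"
  proof (rule card_UN_disjoint[symmetric])
    show "\<forall>S\<in>{S. rich S}. \<forall>S'\<in>{S. rich S}. S \<noteq> S' \<longrightarrow> ?P S \<inter> ?P S' = {}"
    proof (intro ballI impI equals0I)
      fix S S' e
      assume rich: "S \<in> {S. rich S}" "S' \<in> {S. rich S}" "S \<noteq> S'" and e: "e \<in> ?P S \<inter> ?P S'"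
      have "card e \<le> card (N S \<inter> N S')"
        using e finN by (intro card_mono) auto
      then show False
        using rich_common_nbrs_Int[of S S'] rich e by simp
    qed
  qed (use finite_rich finN in auto)
  also have "\<dots> \<le> card {e. e \<subseteq> V \<and> card e = 2}"
    using N_subset finV by (intro card_mono) fastforce+
  also have "\<dots> = card V choose 2"
    using n_subsets[OF finV] by simp
  finally show ?thesis .
qed

lemma copies_eq: "copies (complete_bipartite s s) G = (\<lambda>(A, B). biclique A B) ` sides"
  unfolding copies_complete_bipartite[OF simple] sides_def by auto

subsection \<open>Counting all copies\<close>

text \<open>By \<open>poor_copies_at_edge\<close>, \<open>s * P\<close> bounds the copies without a
  rich side at one edge; \<open>central_choose_eq\<close> identifies \<open>(2 * s + 1) * P\<close>
  with the binomial term of the threshold for \<open>n\<close>.\<close>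

abbreviation "P \<equiv> (2 * s - 1) choose (s - 1)"

lemma P_ge: "2 * s - 1 \<le> P"
  using s3 by (intro self_le_choose) auto

lemma richD:
  assumes "rich S"
  shows "finite S" "S \<subseteq> V" "card S = s" "s + 2 \<le> card (N S)" "N S \<subseteq> V - S" "card (N S) \<le> card V - s"
proof -
  show *: "finite S" "S \<subseteq> V" "card S = s" "s + 2 \<le> card (N S)"
    using assms finV finite_subset by (auto simp: rich_def)
  show **: "N S \<subseteq> V - S"
    using N_subset N_disjoint[of S] by auto
  have "card (N S) \<le> card (V - S)"
    using finV by (intro card_mono **) auto
  then show "card (N S) \<le> card V - s"
    using * by (simp add: card_Diff_subset)
qed

lemma rich_sides: "rich S \<Longrightarrow> B \<subseteq> N S \<Longrightarrow> card B = s \<Longrightarrow> (S, B) \<in> sides"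
  by (simp add: sides_def richD)

lemma copies_subset_rich_poor:
  "copies (complete_bipartite s s) G \<subseteq>
    (\<lambda>(S, B). biclique S B) ` (SIGMA S:{S. rich S}. {B. B \<subseteq> N S \<and> card B = s}) \<union> poor_copies"
  (is "_ \<subseteq> ?R \<union> _")
proof
  have rich: "biclique A B \<in> ?R" if "rich A" "(A, B) \<in> sides" for A B
    using that sidesD(6,7)[OF that(2)] by (intro rev_image_eqI[of "(A, B)"]) auto
  fix Q assume "Q \<in> copies (complete_bipartite s s) G"
  then obtain A B where AB: "(A, B) \<in> sides" and Q: "Q = biclique A B"
    unfolding copies_eq by auto
  consider "rich A" | "rich B" | "(A, B) \<in> poor_sides"
    using AB by (auto simp: poor_sides_def)
  then show "Q \<in> ?R \<union> poor_copies"
  proof cases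
    case 1
    then show ?thesis
      using rich AB Q by simp
  next
    case 2
    then show ?thesis
      using rich[OF 2 sides_swap[OF AB]] Q by (simp add: biclique_commute)
  next
    case 3
    then show ?thesis
      unfolding poor_copies_def Q by (intro UnI2 rev_image_eqI[of "(A, B)"]) auto
  qed
qed

lemma finite_N_subsets: "finite {B. B \<subseteq> N S \<and> card B = s}"
  using finN by simp

text \<open>Copies without a rich side are counted through all their \<open>s\<^sup>2\<close> edges.
  For rich \<open>S\<close>, choosing two marked vertices in an \<open>s\<close>-subset of
  \<open>N S\<close> converts \<open>card (N S) choose s\<close> into pairs times a binomial that
  smallness of \<open>N S\<close> at least halves; \<open>sum_rich_pairs\<close> bounds the
  pairs.\<close>

lemma copies_less_if_no_large_rich:
  assumes n: "3 * s + 1 + (2 * s + 1) * P \<le> card V"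
    and small: "\<And>S. rich S \<Longrightarrow> 2 * card (N S) \<le> card V - s"
  shows "card (copies (complete_bipartite s s) G) < (card V - s) choose s"
proof -
  let ?n = "card V" and ?Z = "SIGMA S:{S. rich S}. {B. B \<subseteq> N S \<and> card B = s}"
  define R where "R = (\<Sum>S | rich S. card (N S) choose s)"
  have finZ: "finite ?Z"
    using finite_rich finite_N_subsets by (intro finite_SigmaI) auto
  have "card ?Z = R"
    unfolding R_def using finite_rich finite_N_subsets n_subsets[OF finN] by (subst card_SigmaI) auto
  moreover have "card (copies (complete_bipartite s s) G) \<le> card ((\<lambda>(S, B). biclique S B) ` ?Z \<union> poor_copies)"
    using finZ finite_poor_copies by (intro card_mono copies_subset_rich_poor) auto
  moreover have "\<dots> \<le> card ?Z + card poor_copies"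
    by (intro order_trans[OF card_Un_le] add_right_mono card_image_le finZ)
  ultimately have le: "card (copies (complete_bipartite s s) G) \<le> R + card poor_copies"
    by linarith
  have "s\<^sup>2 * card poor_copies \<le> s * P * (?n choose 2)"
  proof (rule poor_copies_le)
    fix A B assume "(A, B) \<in> poor_sides"
    then have "(A, B) \<in> sides"
      by (simp add: poor_sidesD)
    from sidesD(1,2,5,6)[OF this] show "s\<^sup>2 \<le> card (A \<inter> V) * card (B \<inter> V)"
      by (simp add: Int_absorb2 power2_eq_square)
  qed auto
  moreover have "2 * ((s choose 2) * R) \<le> (?n choose 2) * ((?n - s - 2) choose (s - 2))"
  proof -
    have "2 * ((s choose 2) * (card (N S) choose s))
        \<le> (card (N S) choose 2) * ((?n - s - 2) choose (s - 2))" if "rich S" for S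
    proof -
      have "(s choose 2) * (card (N S) choose s) = (card (N S) choose 2) * ((card (N S) - 2) choose (s - 2))"
        using choose_mult[of 2 s "card (N S)"] richD(4)[OF that] s3 by (simp add: mult.commute)
      moreover have "2 * ((card (N S) - 2) choose (s - 2)) \<le> (?n - s - 2) choose (s - 2)"
        using small[OF that] s3 by (intro double_choose_le) auto
      ultimately show ?thesis
        by (metis mult.left_commute mult_le_mono2)
    qed
    then have "2 * ((s choose 2) * R)
        \<le> (\<Sum>S | rich S. (card (N S) choose 2) * ((?n - s - 2) choose (s - 2)))"
      unfolding R_def sum_distrib_left by (intro sum_mono) auto
    also have "\<dots> = (\<Sum>S | rich S. card (N S) choose 2) * ((?n - s - 2) choose (s - 2))"
      by (simp add: sum_distrib_right)
    also have "\<dots> \<le> (?n choose 2) * ((?n - s - 2) choose (s - 2))"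
      by (intro mult_right_mono sum_rich_pairs) auto
    finally show ?thesis .
  qed
  ultimately have "R + card poor_copies < (?n - s) choose s"
    using far_from_extremal_bound[OF s3 P_ge n] by blast
  with le show ?thesis by linarith
qed

lemma card_Diff_rich_ge:
  assumes "rich S" "(A, B) \<in> sides" "B \<noteq> S"
  shows "s - 1 \<le> card (A - N S)"
proof -
  note Q = sidesD[OF assms(2)]
  have "card A = card (A \<inter> N S) + card (A - N S)"
    using Q(3) by (rule card_Int_Diff)
  then show ?thesis
    using sides_meet_rich[OF assms] Q(5) by linarith
qed

text \<open>Outside \<open>N S\<close>, the non-rich side of such a copy keeps at least \<open>s - 1 \<ge> 2\<close> vertices, which
  determine the copy, because two rich sets share at most one common neighbour.\<close>

lemma card_other_rich_sides:
  assumes S: "rich S"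
  shows "card (SIGMA S':{S'. rich S' \<and> S' \<noteq> S}. {B. B \<subseteq> N S' \<and> card B = s})
    \<le> (card (V - N S) + 1) choose s" (is "card ?Z \<le> _")
proof -
  let ?U = "V - N S"
  let ?f = "\<lambda>(S', B). B - N S"
  have B: "s - 1 \<le> card (B - N S)" "finite B" "B \<subseteq> V" "card (B \<inter> N S) \<le> 1"
    if "rich S'" "S' \<noteq> S" "B \<subseteq> N S'" "card B = s" for S' B
  proof -
    have AB: "(B, S') \<in> sides"
      using that rich_sides sides_swap by simp
    show "s - 1 \<le> card (B - N S)" "card (B \<inter> N S) \<le> 1"
      using card_Diff_rich_ge[OF S AB that(2)] sides_meet_rich[OF S AB that(2)] by auto
    show "finite B" "B \<subseteq> V"
      using sidesD(1,3)[OF AB] by auto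
  qed
  have "inj_on ?f ?Z"
  proof (rule inj_onI)
    fix q q' assume "q \<in> ?Z" "q' \<in> ?Z" and eq: "?f q = ?f q'"
    then obtain S1 B1 S2 B2 where q: "q = (S1, B1)" "q' = (S2, B2)"
      and 1: "rich S1" "S1 \<noteq> S" "B1 \<subseteq> N S1" "card B1 = s"
      and 2: "rich S2" "S2 \<noteq> S" "B2 \<subseteq> N S2" "card B2 = s"
      by auto
    have eq': "B1 - N S = B2 - N S"
      using eq q by simp
    have "S1 = S2"
    proof (rule ccontr)
      assume "S1 \<noteq> S2"
      have "B1 - N S \<subseteq> N S1 \<inter> N S2"
        using 1(3) 2(3) eq' by auto
      then have "card (B1 - N S) \<le> card (N S1 \<inter> N S2)"
        using finN by (intro card_mono) auto
      then show False
        using rich_common_nbrs_Int[OF 1(1) 2(1) \<open>S1 \<noteq> S2\<close>] B(1)[OF 1] s3 by linarith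
    qed
    have cards: "card (B1 \<inter> N S) = card (B2 \<inter> N S)"
      using card_Int_Diff[OF B(2)[OF 1], of "N S"] card_Int_Diff[OF B(2)[OF 2], of "N S"] eq' 1(4) 2(4)
      by simp
    have "B1 \<inter> N S = B2 \<inter> N S"
    proof (cases "B1 \<inter> N S = {}")
      case True
      then show ?thesis
        using cards B(2)[OF 2] by simp
    next
      case False
      \<comment> \<open>\<open>N S1 \<inter> N S\<close> has at most one vertex, so a nonempty
        subset is all of it; this determines what \<open>B1\<close> and \<open>B2\<close> contribute
        inside \<open>N S\<close>.\<close>
      have eqI: "X = N S1 \<inter> N S" if "X \<subseteq> N S1 \<inter> N S" "0 < card X" for X
        using that rich_common_nbrs_Int[OF 1(1) S 1(2)] finN by (intro card_seteq) auto
      have "B1 \<inter> N S \<subseteq> N S1 \<inter> N S" "B2 \<inter> N S \<subseteq> N S1 \<inter> N S"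
        using 1(3) 2(3) \<open>S1 = S2\<close> by auto
      moreover have "0 < card (B1 \<inter> N S)"
        using False B(2)[OF 1] by (simp add: card_gt_0_iff)
      ultimately have "B1 \<inter> N S = N S1 \<inter> N S" "B2 \<inter> N S = N S1 \<inter> N S"
        using cards by (auto simp only: intro!: eqI)
      then show ?thesis by simp
    qed
    then have "B1 = B2"
      using eq' by (metis Int_Diff_Un)
    then show "q = q'"
      using q \<open>S1 = S2\<close> by simp
  qed
  \<comment> \<open>At most one vertex is lost, so the images have size \<open>s\<close> or
    \<open>s - 1\<close>; Pascal's rule merges the two counts, which is the source of the
    \<open>+ 1\<close> in the bound.\<close>
  moreover have "?f ` ?Z \<subseteq> {T. T \<subseteq> ?U \<and> card T = s} \<union> {T. T \<subseteq> ?U \<and> card T = s - 1}"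
  proof
    fix T assume "T \<in> ?f ` ?Z"
    then obtain S' B where SB: "rich S'" "S' \<noteq> S" "B \<subseteq> N S'" "card B = s" and T: "T = B - N S"
      by auto
    have "card T \<le> s"
      using card_mono[OF B(2)[OF SB], of T] SB(4) T by auto
    then have "card T = s \<or> card T = s - 1"
      using B(1)[OF SB] unfolding T by linarith
    then show "T \<in> {T. T \<subseteq> ?U \<and> card T = s} \<union> {T. T \<subseteq> ?U \<and> card T = s - 1}"
      using B(3)[OF SB] T by auto
  qed
  ultimately have "card ?Z \<le> card ({T. T \<subseteq> ?U \<and> card T = s} \<union> {T. T \<subseteq> ?U \<and> card T = s - 1})"
    using finV by (intro card_inj_on_le) auto
  also have "\<dots> \<le> card {T. T \<subseteq> ?U \<and> card T = s} + card {T. T \<subseteq> ?U \<and> card T = s - 1}"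
    by (rule card_Un_le)
  also have "\<dots> = (card ?U choose s) + (card ?U choose (s - 1))"
    using finV n_subsets[of ?U] by simp
  also have "\<dots> = (card ?U + 1) choose s"
    using s3 by (cases s) auto
  finally show ?thesis .
qed

text \<open>Three groups are counted: copies with side \<open>S\<close>, copies with another rich
  side, and copies without a rich side. The last keep at least \<open>s - 1\<close> vertices per
  side in \<open>V - N S\<close>, a set of only \<open>r + s\<close> vertices, so
  \<open>poor_copies_le\<close> is applied there with \<open>(s - 1)\<^sup>2\<close> edges per
  copy.\<close>

lemma copies_less_if_large_rich:
  assumes n: "3 * s + 1 + (2 * s + 1) * P \<le> card V"
    and S: "rich S" and large: "card V - s < 2 * card (N S)" "card (N S) < card V - s"
  shows "card (copies (complete_bipartite s s) G) < (card V - s) choose s"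
proof -
  let ?n = "card V" and ?m = "card (N S)"
  define r where "r = ?n - s - ?m"
  have nmr: "?n = ?m + r + s" "1 \<le> r" "r < ?m"
    using large unfolding r_def by auto
  have U: "card (V - N S) = r + s"
    using nmr(1) finN N_subset by (simp add: card_Diff_subset)
  let ?T = "{B. B \<subseteq> N S \<and> card B = s}"
  let ?Z = "SIGMA S':{S'. rich S' \<and> S' \<noteq> S}. {B. B \<subseteq> N S' \<and> card B = s}"
  have finT: "finite ?T" and finZ: "finite ?Z"
    using finite_N_subsets finite_rich by (auto intro!: finite_SigmaI intro: finite_subset[rotated])
  have "copies (complete_bipartite s s) G \<subseteq> biclique S ` ?T \<union> (\<lambda>(S', B). biclique S' B) ` ?Z \<union> poor_copies"
    using copies_subset_rich_poor by fastforce
  then have "card (copies (complete_bipartite s s) G)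
      \<le> card (biclique S ` ?T \<union> (\<lambda>(S', B). biclique S' B) ` ?Z \<union> poor_copies)"
    using finT finZ finite_poor_copies by (intro card_mono) auto
  also have "\<dots> \<le> card (biclique S ` ?T) + card ((\<lambda>(S', B). biclique S' B) ` ?Z) + card poor_copies"
    by (intro order_trans[OF card_Un_le] add_right_mono card_Un_le)
  also have "\<dots> \<le> card ?T + card ?Z + card poor_copies"
    by (intro add_right_mono add_mono card_image_le finT finZ)
  also have "\<dots> \<le> (?m choose s) + ((r + s + 1) choose s) + card poor_copies"
    using card_other_rich_sides[OF S] n_subsets[OF finN, of S s] unfolding U by simp
  also have "\<dots> < (?n - s) choose s"
  proof (rule near_extremal_bound[OF s3 nmr P_ge n])
    show "(s - 1)\<^sup>2 * card poor_copies \<le> s * P * ((r + s) choose 2)"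
      unfolding U[symmetric]
    proof (rule poor_copies_le)
      fix A B assume AB: "(A, B) \<in> poor_sides"
      then have sides: "(A, B) \<in> sides" "(B, A) \<in> sides" and ne: "B \<noteq> S" "A \<noteq> S"
        using poor_sidesD[OF AB] S sides_swap by auto
      have "A \<inter> (V - N S) = A - N S" "B \<inter> (V - N S) = B - N S"
        using sidesD(1,2)[OF sides(1)] by auto
      then show "(s - 1)\<^sup>2 \<le> card (A \<inter> (V - N S)) * card (B \<inter> (V - N S))"
        using card_Diff_rich_ge[OF S sides(1) ne(1)] card_Diff_rich_ge[OF S sides(2) ne(2)]
        by (simp add: power2_eq_square mult_le_mono)
    qed auto
  qed
  finally show ?thesis .
qed

text \<open>Here \<open>N S = V - S\<close>, so a copy with neither side equal to \<open>S\<close>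
  would place \<open>s - 1\<close> vertices of each side into \<open>S\<close>, but
  \<open>2 * (s - 1) > s\<close>. Hence a copy amounts to choosing an \<open>s\<close>-subset of
  \<open>N S\<close>.\<close>

lemma copies_le_if_full_rich:
  assumes S: "rich S" and full: "card (N S) = card V - s"
  shows "card (copies (complete_bipartite s s) G) \<le> (card V - s) choose s"
proof -
  have NS: "N S = V - S"
    using richD[OF S] full finV by (intro card_subset_eq) (auto simp: card_Diff_subset)
  have "A = S \<or> B = S" if AB: "(A, B) \<in> sides" for A B
  proof (rule ccontr)
    assume "\<not> ?thesis"
    then have "s - 1 \<le> card (A - N S)" "s - 1 \<le> card (B - N S)"
      using card_Diff_rich_ge[OF S] AB sides_swap[OF AB] by auto
    moreover have "card (A - N S) + card (B - N S) = card ((A - N S) \<union> (B - N S))"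
      using sidesD(3,4,9)[OF AB] by (intro card_Un_disjoint[symmetric]) auto
    moreover have "\<dots> \<le> card S"
      using sidesD(1,2)[OF AB] richD(1)[OF S] NS by (intro card_mono) auto
    ultimately show False
      using richD(3)[OF S] s3 by linarith
  qed
  note one_side = this
  have "copies (complete_bipartite s s) G \<subseteq> biclique S ` {B. B \<subseteq> N S \<and> card B = s}"
  proof
    fix Q assume "Q \<in> copies (complete_bipartite s s) G"
    then obtain A B where AB: "(A, B) \<in> sides" and Q: "Q = biclique A B"
      unfolding copies_eq by auto
    from one_side[OF AB] show "Q \<in> biclique S ` {B. B \<subseteq> N S \<and> card B = s}"
    proof
      assume "A = S"
      then show ?thesis
        using Q sidesD(6,7)[OF AB] by auto
    next
      assume "B = S"
      then show ?thesis
        using Q sidesD(5,8)[OF AB] by (auto simp: biclique_commute[of A])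
    qed
  qed
  then have "card (copies (complete_bipartite s s) G) \<le> card {B. B \<subseteq> N S \<and> card B = s}"
    by (intro order_trans[OF card_mono card_image_le] finite_imageI finite_N_subsets)
  then show ?thesis
    using n_subsets[OF finN, of S s] full by simp
qed

section \<open>The dichotomy and the structure of extremal graphs\<close>

lemma copies_dichotomy:
  assumes n: "3 * s + 1 + (2 * s + 1) * P \<le> card V"
  shows "card (copies (complete_bipartite s s) G) < (card V - s) choose s \<or>
    card (copies (complete_bipartite s s) G) \<le> (card V - s) choose s \<and>
      (\<exists>S. rich S \<and> card (N S) = card V - s)"
proof (cases "\<exists>S. rich S \<and> card V - s < 2 * card (N S)")
  case True
  then obtain S where S: "rich S" "card V - s < 2 * card (N S)" by blast
  show ?thesis
  proof (cases "card (N S) = card V - s")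
    case True
    then show ?thesis
      using copies_le_if_full_rich S by blast
  next
    case False
    then have "card (N S) < card V - s"
      using richD(6)[OF S(1)] by linarith
    then show ?thesis
      using copies_less_if_large_rich[OF n S] by blast
  qed
next
  case False
  then show ?thesis
    using copies_less_if_no_large_rich[OF n] by (metis not_less)
qed

text \<open>Since \<open>N S = V - S\<close>, all edges between \<open>S\<close> and the rest are
  present, and \<open>rich_single_edge\<close> allows at most one edge outside \<open>S\<close>.
  Numbering \<open>S\<close> and \<open>N S\<close> separately embeds \<open>G\<close> into the
  join.\<close>

lemma full_rich_structure:
  assumes S: "rich S" and full: "card (N S) = card V - s"
  shows "contains_copy G (complete_bipartite s (card V - s))"
    and "\<exists>H :: nat graph. simple_graph H \<and> card (verts H) = card V - s \<and> card (edges H) = 1 \<and>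
      contains_copy (join (complete_graph s) H) G"
proof -
  let ?k = "card V - s"
  note R = richD[OF S]
  have NS: "N S = V - S"
    using R full finV by (intro card_subset_eq) (auto simp: card_Diff_subset)
  have "biclique S (N S) \<in> copies (complete_bipartite s ?k) G"
    unfolding copies_complete_bipartite[OF simple] using R full by auto
  then show "contains_copy G (complete_bipartite s ?k)"
    by (auto simp: contains_copy_def)
  obtain g h where g: "bij_betw g S {..<s}" and h: "bij_betw h (N S) {..<?k}"
    using ex_bij_betw_finite_nat[OF R(1)] ex_bij_betw_finite_nat[OF finN[of S]] R(3) full
    by (metis atLeast0LessThan)
  have k: "2 \<le> ?k"
    using R(4) full by simp
  have h_edge: "\<exists>i j. i < ?k \<and> j < ?k \<and> i \<noteq> j \<and>
      (\<forall>a\<in>N S. \<forall>b\<in>N S. adj a b \<longrightarrow> {h a, h b} = {i, j})"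
  proof (cases "\<exists>a\<in>N S. \<exists>b\<in>N S. adj a b")
    case True
    then obtain a b where ab: "a \<in> N S" "b \<in> N S" "adj a b" by blast
    have "h a \<noteq> h b"
      using ab h not_adj_self by (metis bij_betw_def inj_onD)
    moreover have "h a < ?k" "h b < ?k"
      using ab h by (auto simp: bij_betw_def)
    moreover have "{h a', h b'} = {h a, h b}" if "a' \<in> N S" "b' \<in> N S" "adj a' b'" for a' b'
      using arg_cong[OF rich_single_edge[OF S that(1,2) ab(1,2) that(3) ab(3)], of "(`) h"] by simp
    ultimately show ?thesis by blast
  next
    case False
    \<comment> \<open>Without an edge inside \<open>N S\<close>, any pair can serve as the edge of
      \<open>H\<close>; two vertices are available because \<open>k\<close> holds.\<close>
    then show ?thesis
      using k by (intro exI[of _ 0] exI[of _ 1]) auto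
  qed
  then obtain i j where ij: "i < ?k" "j < ?k" "i \<noteq> j"
    and e: "\<And>a b. a \<in> N S \<Longrightarrow> b \<in> N S \<Longrightarrow> adj a b \<Longrightarrow> {h a, h b} = {i, j}"
    by blast
  define H :: "nat graph" where "H = ({..<?k}, {{i, j}})"
  have H: "simple_graph H" "card (verts H) = ?k" "card (edges H) = 1"
    using ij by (auto simp: H_def simple_graph_def)
  define f where "f v = (if v \<in> S then Inl (g v) else Inr (h v))" for v
  have gS: "g v < s" if "v \<in> S" for v
    using that g by (auto simp: bij_betw_def)
  have hN: "h v < ?k" if "v \<in> V" "v \<notin> S" for v
    using that h NS by (auto simp: bij_betw_def)
  have "contains_copy (join (complete_graph s) H) G"
  proof (rule contains_copyI[of _ _ f])
    show "simple_graph (join (complete_graph s) H)"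
      by (intro simple_graph_join simple_complete_graph H)
    show "inj_on f V"
      unfolding f_def using g h NS by (auto simp: inj_on_def bij_betw_def)
    show "f ` V \<subseteq> verts (join (complete_graph s) H)"
      using gS hN by (auto simp: f_def join_def complete_graph_def H_def)
    show "f ` e' \<in> edges (join (complete_graph s) H)" if e': "e' \<in> edges G" for e'
    proof -
      obtain u v where uv: "e' = {u, v}"
        using simple e' unfolding simple_graph_def by (meson card_2_iff)
      then have adj: "adj u v" and V: "u \<in> V" "v \<in> V" and "u \<noteq> v"
        using e' adj_verts[of u v] not_adj_self[of u] by auto
      have mixed: "{Inl (g x), Inr (h y)} \<in> edges (join (complete_graph s) H)"
        if "x \<in> S" "y \<in> V" "y \<notin> S" for x y
        using gS[OF that(1)] hN[OF that(2,3)] by (auto simp: join_def complete_graph_def H_def)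
      consider "u \<in> S" "v \<in> S" | "u \<in> S" "v \<notin> S" | "u \<notin> S" "v \<in> S" | "u \<notin> S" "v \<notin> S"
        by blast
      then show ?thesis
      proof cases
        case 1
        then have "g u \<noteq> g v"
          using g \<open>u \<noteq> v\<close> by (auto simp: bij_betw_def inj_on_def)
        then have "{g u, g v} \<in> edges (complete_graph s)"
          using gS 1 by (auto simp: complete_graph_def)
        then have "Inl ` {g u, g v} \<in> edges (join (complete_graph s) H)"
          unfolding join_def snd_conv by (intro UnI1 imageI)
        then show ?thesis
          using 1 uv by (simp add: f_def)
      next
        case 2
        then show ?thesis
          using mixed[of u v] V uv by (simp add: f_def insert_commute)
      next
        case 3
        then show ?thesis
          using mixed[of v u] V uv by (simp add: f_def insert_commute)
      next
        case 4
        then have "f ` e' = Inr ` {i, j}"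
          using e[of u v] V NS adj uv by (auto simp: f_def)
        then show ?thesis
          by (simp add: join_def H_def)
      qed
    qed
  qed (rule simple)
  then show "\<exists>H :: nat graph. simple_graph H \<and> card (verts H) = ?k \<and> card (edges H) = 1 \<and>
      contains_copy (join (complete_graph s) H) G"
    using H by blast
qed

end

section \<open>The threshold and the extremal number\<close>

lemma copies_upper_bound:
  fixes G :: "'a graph"
  assumes s: "3 \<le> s" and n: "3 * s + 1 + (2 * s + 1) * ((2 * s - 1) choose (s - 1)) \<le> n"
    and free: "free_graph n (cycle_graph (2 * s + 2)) G"
  shows "card (copies (complete_bipartite s s) G) < (n - s) choose s \<or>
    card (copies (complete_bipartite s s) G) \<le> (n - s) choose s \<and>
      contains_copy G (complete_bipartite s (n - s)) \<and>
      (\<exists>H :: nat graph. simple_graph H \<and> card (verts H) = n - s \<and> card (edges H) = 1 \<and>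
         contains_copy (join (complete_graph s) H) G)"
proof -
  have G: "simple_graph G" "card (verts G) = n" "\<not> contains_copy G (cycle_graph (2 * s + 2))"
    using free by (auto simp: free_graph_def)
  interpret even_cycle_free G s
    using G s by unfold_locales
  from copies_dichotomy[unfolded G(2), OF n] show ?thesis
  proof (elim disjE conjE exE)
    fix S assume "rich S" "card (N S) = n - s"
      and "card (copies (complete_bipartite s s) G) \<le> (n - s) choose s"
    then show ?thesis
      using full_rich_structure[of S] unfolding G(2) by blast
  qed blast
qed

text \<open>Absorption reduces \<open>(2 * s + 1) choose s\<close> to the central binomial
  \<open>(2 * s) choose s\<close>, which is twice \<open>(2 * s - 1) choose (s - 1)\<close>.\<close>

lemma central_choose_eq:
  fixes s :: nat
  assumes "1 \<le> s"
  shows "2 * ((2 * s + 1) * ((2 * s - 1) choose (s - 1))) = (s + 1) * ((2 * s + 1) choose s)"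
proof -
  have "(s + 1) * ((2 * s + 1) choose s) = (s + 1) * ((2 * s + 1) choose (s + 1))"
    using binomial_symmetric[of s "2 * s + 1"] by simp
  also have "\<dots> = (2 * s + 1) * ((2 * s) choose s)"
    using Suc_times_binomial[of s "2 * s"] by simp
  also have "s * ((2 * s) choose s) = s * (2 * ((2 * s - 1) choose (s - 1)))"
    using times_binomial_minus1_eq[of s "2 * s"] assms by simp
  then have "(2 * s) choose s = 2 * ((2 * s - 1) choose (s - 1))"
    using assms by simp
  finally show ?thesis by simp
qed

theorem theorem4:
  fixes n s :: nat
  assumes "s \<ge> 3"
    and "real n \<ge> 3 * real s + 1 + real ((2 * s + 1) choose s) * ((real s + 1) / 2)"
  shows "gen_turan n (complete_bipartite s s) (cycle_graph (2 * s + 2)) = (n - s) choose s \<and>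
    (\<forall>G :: 'a graph.
       free_graph n (cycle_graph (2 * s + 2)) G \<and>
       card (copies (complete_bipartite s s) G)
         = gen_turan n (complete_bipartite s s) (cycle_graph (2 * s + 2)) \<longrightarrow>
       contains_copy G (complete_bipartite s (n - s)) \<and>
       (\<exists>H :: nat graph. simple_graph H \<and> card (verts H) = n - s \<and> card (edges H) = 1 \<and>
          contains_copy (join (complete_graph s) H) G))"
proof -
  let ?C = "cycle_graph (2 * s + 2)" and ?K = "complete_bipartite s s"
  let ?P = "(2 * s - 1) choose (s - 1)"
  have n: "3 * s + 1 + (2 * s + 1) * ?P \<le> n"
  proof -
    have "real (2 * ((2 * s + 1) * ?P)) = real ((s + 1) * ((2 * s + 1) choose s))"
      using central_choose_eq[of s] assms(1) by simp
    then have "real ((2 * s + 1) choose s) * ((real s + 1) / 2) = real ((2 * s + 1) * ?P)"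
      by (simp add: field_simps)
    then have "real (3 * s + 1 + (2 * s + 1) * ?P) \<le> real n"
      using assms(2) by linarith
    then show ?thesis
      by (simp only: of_nat_le_iff)
  qed
  \<comment> \<open>The bound stays polymorphic in the vertex type: it serves graphs on
    \<open>nat\<close> for the maximum and graphs on \<open>'a\<close> for the structure.\<close>
  note upper = copies_upper_bound[OF assms(1) n]
  \<comment> \<open>The complete bipartite graph with parts of sizes \<open>s\<close> and
    \<open>n - s\<close> is the extremal example: a cycle of length \<open>2 * (s + 1)\<close> would
    need \<open>s + 1\<close> vertices in the part of size \<open>s\<close>.\<close>
  let ?B = "biclique {..<s} {s..<n}"
  have B: "free_graph n ?C ?B"
  proof -
    have "simple_graph ?B"
      by (rule simple_biclique) auto
    moreover have "{..<s} \<union> {s..<n} = {..<n}"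
      using n by auto
    then have "card (verts ?B) = n"
      by (simp add: biclique_def)
    moreover have "\<not> contains_copy ?B ?C"
      using biclique_no_long_cycle[of "{..<s}" "s + 1"] by simp
    ultimately show ?thesis
      by (simp add: free_graph_def)
  qed
  have "{..<s} \<inter> {s..<n} = {}"
    by auto
  then have "(n - s) choose s \<le> card (copies ?K ?B)"
    using card_copies_biclique_ge[of "{..<s}" "{s..<n}" s s] by simp
  then have eq: "card (copies ?K ?B) = (n - s) choose s"
    using upper[OF B] by linarith
  have "gen_turan n ?K ?C = (n - s) choose s"
    unfolding gen_turan_def
  proof (rule Max_eqI[OF finite_gen_turan_values])
    fix c assume "c \<in> {card (copies ?K G) |G :: nat graph. free_graph n ?C G}"
    then obtain G :: "nat graph" where "c = card (copies ?K G)" "free_graph n ?C G"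
      by blast
    then show "c \<le> (n - s) choose s"
      using upper[of G] by linarith
  next
    show "(n - s) choose s \<in> {card (copies ?K G) |G :: nat graph. free_graph n ?C G}"
      using B eq by (metis (mono_tags, lifting) mem_Collect_eq)
  qed
  \<comment> \<open>Attaining the maximum excludes the strict alternative in \<open>upper\<close>,
    leaving the structural one.\<close>
  then show ?thesis
    using upper by (metis less_irrefl)
qed

end
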